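(* Consider a shock-free solution of the Lagrangian compressible Euler equations for a polytropic ideal gas, with entropy variable $m=m(x)$. If the entropy $m(x)$ (equivalently $S(x)$) is non-decreasing, then a forward $R$ (resp. $C$) can change its character only if it crosses backward $C$ waves (resp. backward $R$ waves); a backward $C$ (resp. $R$) can change its character only if it crosses a forward $C$ (resp. forward $R$). Symmetric results hold if $m(x)$ is non-increasing, provided the character of the opposite simple wave is reversed: a forward $R$ (resp. $C$) can change its character only if it crosses backward $R$ (resp. $C$) waves, and a backward $C$ (resp. $R$) can change only if it crosses a forward $R$ (resp. $C$).
   Context: Equations. Fix constants $\gamma>1$, $K>0$, $c_v>0$. The Lagrangian compressible Euler equations are $$\tau_t-u_x=0,\quad u_t+p_x=0,\quad (\tfrac12u^2+e)_t+(up)_x=0,$$ with specific volume $\tau$, velocity $u$, pressure $p=Ke^{S/c_v}\tau^{-\gamma}$, entropy $S$, and $e=p\tau/(\gamma-1)$. For classical solutions the third equation can be replaced by $S_t=0$. Set $d=\frac{\gamma+1}{\gamma-1}$, $C_z=(d-1)^{1/(1-d)}$, $C_m=\sqrt{K\gamma}\,C_z^{-d}$, $m=C_me^{S/2c_v}$ (the entropy variable) and $z=C_z\tau^{-(\gamma-1)/2}$. Then the Lagrangian sound speed is $c=\sqrt{-p_\tau}=mz^d$, and $p=\frac{m^2z^{1+d}}{d+1}$, $\tau=\frac{z^{1-d}}{d-1}$. Shock-free solution: a solution in which the velocity $u$ and pressure $p$ are $C^2$, while the entropy $S(x)$ is $C^2$ except at finitely many points, and one-sided limits of $S$ and $S_x$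 exist everywhere. $R/C$ character: forward (resp. backward) characteristics are the curves with $dx/dt=c$ (resp. $dx/dt=-c$). Define $$\alpha=-\frac{p_t-c\,p_x}{c^2}=u_x+mz_x+\tfrac2{d+1}m_xz,\qquad \beta=-\frac{p_t+c\,p_x}{c^2}=u_x-mz_x-\tfrac2{d+1}m_xz,$$ understood through one-sided limits at the exceptional points of the entropy. The local character is: forward rarefactive ($R$) iff $\alpha>0$; forward compressive ($C$) iff $\alpha<0$; backward $R$ iff $\beta>0$; backward $C$ iff $\beta<0$. A forward wave is followed along a forward characteristic; it changes character if the sign of $\alpha$ does not persist along that characteristic, and it crosses backward $C$ (resp. $R$) waves if $\beta<0$ (resp. $\beta>0$) somewhere along it. Backward waves are treated likewise along backward characteristics, with $\alpha$ and $\beta$ exchanged. *)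

theory Defs
  imports "HOL-Analysis.Analysis"
begin

text \<open>
  Fields are functions of the Lagrangian space variable and of time, in this order. The domain
  of a solution is \<open>I \<times> J\<close> with \<open>I\<close> an open interval (possibly the whole line) of positions and
  \<open>J\<close> an arbitrary nondegenerate interval of times. Time derivatives are taken within \<open>J\<close>, so
  that an initial time may belong to \<open>J\<close>.
\<close>

section \<open>Polytropic ideal gas\<close>

definition pressure_law :: "real \<Rightarrow> real \<Rightarrow> real \<Rightarrow> real \<Rightarrow> real \<Rightarrow> real" where
  "pressure_law \<gamma> K c\<^sub>v s v = K * exp (s / c\<^sub>v) * v powr (- \<gamma>)"

definition sound_speed :: "real \<Rightarrow> real \<Rightarrow> real \<Rightarrow> real \<Rightarrow> real \<Rightarrow> real" where
  "sound_speed \<gamma> K c\<^sub>v s v = sqrt (- deriv (pressure_law \<gamma> K c\<^sub>v s) v)"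

definition d_const :: "real \<Rightarrow> real" where
  "d_const \<gamma> = (\<gamma> + 1) / (\<gamma> - 1)"

definition Cz_const :: "real \<Rightarrow> real" where
  "Cz_const \<gamma> = (d_const \<gamma> - 1) powr (1 / (1 - d_const \<gamma>))"

definition Cm_const :: "real \<Rightarrow> real \<Rightarrow> real" where
  "Cm_const \<gamma> K = sqrt (K * \<gamma>) * Cz_const \<gamma> powr (- d_const \<gamma>)"

definition m_var :: "real \<Rightarrow> real \<Rightarrow> real \<Rightarrow> real \<Rightarrow> real" where
  "m_var \<gamma> K c\<^sub>v s = Cm_const \<gamma> K * exp (s / (2 * c\<^sub>v))"

definition z_var :: "real \<Rightarrow> real \<Rightarrow> real" where
  "z_var \<gamma> v = Cz_const \<gamma> * v powr (- ((\<gamma> - 1) / 2))"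

lemma sound_speed_explicit:
  assumes "v > 0"
  shows "sound_speed \<gamma> K c\<^sub>v s v = sqrt (K * \<gamma> * exp (s / c\<^sub>v) * v powr (- \<gamma> - 1))"
proof -
  have "(pressure_law \<gamma> K c\<^sub>v s has_real_derivative
          K * exp (s / c\<^sub>v) * (- \<gamma> * v powr (- \<gamma> - 1))) (at v)"
    unfolding pressure_law_def using assms
    by (auto intro!: derivative_eq_intros simp: powr_diff field_simps)
  from DERIV_imp_deriv[OF this] show ?thesis
    by (simp add: sound_speed_def mult_ac)
qed

lemma d_minus_one: "\<gamma> > 1 \<Longrightarrow> d_const \<gamma> - 1 = 2 / (\<gamma> - 1)"
  by (simp add: d_const_def field_simps)

lemma Cz_pos: "\<gamma> > 1 \<Longrightarrow> Cz_const \<gamma> > 0"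
  by (simp add: Cz_const_def d_minus_one)

lemma sound_speed_eq:
  assumes "\<gamma> > 1" "K > 0" "v > 0"
  shows "sound_speed \<gamma> K c\<^sub>v s v = m_var \<gamma> K c\<^sub>v s * z_var \<gamma> v powr d_const \<gamma>"
proof -
  have exps: "(\<gamma> - 1) / 2 * d_const \<gamma> = (\<gamma> + 1) / 2"
    using assms by (simp add: d_const_def divide_simps)
  have "z_var \<gamma> v powr d_const \<gamma>
      = Cz_const \<gamma> powr d_const \<gamma> * v powr (- ((\<gamma> - 1) / 2 * d_const \<gamma>))"
    using Cz_pos[OF assms(1)] by (simp add: z_var_def powr_mult powr_powr)
  hence "m_var \<gamma> K c\<^sub>v s * z_var \<gamma> v powr d_const \<gamma>
      = sqrt (K * \<gamma>) * exp (s / (2 * c\<^sub>v)) * v powr (- ((\<gamma> + 1) / 2))"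
    using Cz_pos[OF assms(1)] unfolding exps
    by (simp add: m_var_def Cm_const_def powr_minus field_simps)
  moreover have "sqrt (exp (s / c\<^sub>v)) = exp (s / (2 * c\<^sub>v))"
    by (rule real_sqrt_unique) (simp_all add: power2_eq_square flip: exp_add)
  moreover have "sqrt (v powr (- \<gamma> - 1)) = v powr (- ((\<gamma> + 1) / 2))"
    by (rule real_sqrt_unique) (simp_all add: power2_eq_square flip: powr_add)
  ultimately show ?thesis
    using assms by (simp add: sound_speed_explicit real_sqrt_mult)
qed

section \<open>Shock-free solutions\<close>

definition dx :: "(real \<Rightarrow> real \<Rightarrow> real) \<Rightarrow> real \<Rightarrow> real \<Rightarrow> real" where
  "dx f x t = deriv (\<lambda>y. f y t) x"

definition dt :: "real set \<Rightarrow> (real \<Rightarrow> real \<Rightarrow> real) \<Rightarrow> real \<Rightarrow> real \<Rightarrow> real" where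
  "dt J f x t = vector_derivative (\<lambda>s. f x s) (at t within J)"

definition has_partials_on ::
    "real set \<Rightarrow> real set \<Rightarrow> (real \<Rightarrow> real \<Rightarrow> real) \<Rightarrow> (real \<Rightarrow> real \<Rightarrow> real) \<Rightarrow> (real \<Rightarrow> real \<Rightarrow> real) \<Rightarrow> bool" where
  "has_partials_on I J f fx ft \<longleftrightarrow>
    (\<forall>x\<in>I. \<forall>t\<in>J. ((\<lambda>y. f y t) has_real_derivative fx x t) (at x)
               \<and> ((\<lambda>s. f x s) has_real_derivative ft x t) (at t within J))"

definition C2_on :: "real set \<Rightarrow> real set \<Rightarrow> (real \<Rightarrow> real \<Rightarrow> real) \<Rightarrow> bool" where
  "C2_on I J f \<longleftrightarrow>
    (\<exists>fx ft fxx fxt ftx ftt.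
        has_partials_on I J f fx ft \<and> has_partials_on I J fx fxx fxt \<and> has_partials_on I J ft ftx ftt
      \<and> (\<forall>g\<in>{f, fx, ft, fxx, fxt, ftx, ftt}. continuous_on (I \<times> J) (\<lambda>(x, t). g x t)))"

text \<open>
  \<open>E\<close> is the finite set of exceptional points of the entropy. It is not required that the entropy
  be irregular at every point of \<open>E\<close>. Values of \<open>S\<close> at points of \<open>E\<close> are never used.
\<close>

definition piecewise_C2_entropy :: "real set \<Rightarrow> real set \<Rightarrow> (real \<Rightarrow> real) \<Rightarrow> bool" where
  "piecewise_C2_entropy I E S \<longleftrightarrow>
     finite E
   \<and> (\<exists>S' S''. (\<forall>x\<in>I - E. (S has_real_derivative S' x) (at x) \<and> (S' has_real_derivative S'' x) (at x))
             \<and> continuous_on (I - E) S'')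
   \<and> (\<forall>x\<in>I. \<forall>F\<in>{at_left x, at_right x}. (\<exists>l. (S \<longlongrightarrow> l) F) \<and> (\<exists>l. (deriv S \<longlongrightarrow> l) F))"

text \<open>
  The conservation laws and the equation of state are imposed off the exceptional points. Across
  an exceptional point \<open>u\<close> and \<open>p\<close> are continuous, which are the jump conditions for a stationary
  contact discontinuity. Off \<open>E\<close>, all derivatives occurring below exist because \<open>u\<close> and \<open>p\<close> are
  \<open>C\<^sup>2\<close> and \<open>\<tau>\<close> is determined by \<open>p\<close> and \<open>S\<close>. The requirement \<open>p > 0\<close> excludes vacuum also along
  the exceptional lines.
\<close>

definition euler_equations ::
    "real \<Rightarrow> real \<Rightarrow> real \<Rightarrow> real set \<Rightarrow> real set \<Rightarrow> (real \<Rightarrow> real \<Rightarrow> real) \<Rightarrow> (real \<Rightarrow> real \<Rightarrow> real)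
     \<Rightarrow> (real \<Rightarrow> real \<Rightarrow> real) \<Rightarrow> (real \<Rightarrow> real) \<Rightarrow> bool" where
  "euler_equations \<gamma> K c\<^sub>v A J \<tau> u p S \<longleftrightarrow>
    (\<forall>x\<in>A. \<forall>t\<in>J.
        \<tau> x t > 0
      \<and> p x t = pressure_law \<gamma> K c\<^sub>v (S x) (\<tau> x t)
      \<and> dt J \<tau> x t - dx u x t = 0
      \<and> dt J u x t + dx p x t = 0
      \<and> dt J (\<lambda>y s. (u y s)\<^sup>2 / 2 + p y s * \<tau> y s / (\<gamma> - 1)) x t + dx (\<lambda>y s. u y s * p y s) x t = 0)"

definition shock_free_solution ::
    "real \<Rightarrow> real \<Rightarrow> real \<Rightarrow> real set \<Rightarrow> real set \<Rightarrow> real set \<Rightarrow> (real \<Rightarrow> real \<Rightarrow> real)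
     \<Rightarrow> (real \<Rightarrow> real \<Rightarrow> real) \<Rightarrow> (real \<Rightarrow> real \<Rightarrow> real) \<Rightarrow> (real \<Rightarrow> real) \<Rightarrow> bool" where
  "shock_free_solution \<gamma> K c\<^sub>v I J E \<tau> u p S \<longleftrightarrow>
     open I \<and> is_interval I \<and> is_interval J \<and> interior J \<noteq> {}
   \<and> C2_on I J u \<and> C2_on I J p \<and> (\<forall>x\<in>I. \<forall>t\<in>J. p x t > 0)
   \<and> piecewise_C2_entropy I E S
   \<and> euler_equations \<gamma> K c\<^sub>v (I - E) J \<tau> u p S"

section \<open>Characteristics and rarefactive or compressive character\<close>

definition c_field ::
    "real \<Rightarrow> real \<Rightarrow> real \<Rightarrow> (real \<Rightarrow> real \<Rightarrow> real) \<Rightarrow> (real \<Rightarrow> real) \<Rightarrow> real \<Rightarrow> real \<Rightarrow> real" where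
  "c_field \<gamma> K c\<^sub>v \<tau> S x t = sound_speed \<gamma> K c\<^sub>v (S x) (\<tau> x t)"

text \<open>
  The sound speed \<open>c\<close> may jump at an exceptional point. There the characteristic equation is read
  with one-sided time derivatives: a forward characteristic comes from the left and leaves to the
  right, a backward one comes from the right and leaves to the left. Away from the exceptional
  points \<open>c\<close> is continuous in \<open>x\<close>, and this is the usual equation.
\<close>

definition forward_characteristic ::
    "real set \<Rightarrow> real set \<Rightarrow> (real \<Rightarrow> real \<Rightarrow> real) \<Rightarrow> (real \<Rightarrow> real) \<Rightarrow> real \<Rightarrow> real \<Rightarrow> bool" where
  "forward_characteristic I J c X t\<^sub>0 t\<^sub>1 \<longleftrightarrow>
     t\<^sub>0 < t\<^sub>1 \<and> {t\<^sub>0..t\<^sub>1} \<subseteq> J \<and> X ` {t\<^sub>0..t\<^sub>1} \<subseteq> I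
   \<and> (\<forall>t\<in>{t\<^sub>0..<t\<^sub>1}. (X has_real_derivative Lim (at_right (X t)) (\<lambda>y. c y t)) (at_right t))
   \<and> (\<forall>t\<in>{t\<^sub>0<..t\<^sub>1}. (X has_real_derivative Lim (at_left (X t)) (\<lambda>y. c y t)) (at_left t))"

definition backward_characteristic ::
    "real set \<Rightarrow> real set \<Rightarrow> (real \<Rightarrow> real \<Rightarrow> real) \<Rightarrow> (real \<Rightarrow> real) \<Rightarrow> real \<Rightarrow> real \<Rightarrow> bool" where
  "backward_characteristic I J c X t\<^sub>0 t\<^sub>1 \<longleftrightarrow>
     t\<^sub>0 < t\<^sub>1 \<and> {t\<^sub>0..t\<^sub>1} \<subseteq> J \<and> X ` {t\<^sub>0..t\<^sub>1} \<subseteq> I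
   \<and> (\<forall>t\<in>{t\<^sub>0..<t\<^sub>1}. (X has_real_derivative - Lim (at_left (X t)) (\<lambda>y. c y t)) (at_right t))
   \<and> (\<forall>t\<in>{t\<^sub>0<..t\<^sub>1}. (X has_real_derivative - Lim (at_right (X t)) (\<lambda>y. c y t)) (at_left t))"

text \<open>
  On solutions, with \<open>m\<close> and \<open>z\<close> evaluated along the solution, these are
  \<open>u\<^sub>x + m z\<^sub>x + 2/(d+1) m\<^sub>x z\<close> and \<open>u\<^sub>x - m z\<^sub>x - 2/(d+1) m\<^sub>x z\<close> off the exceptional points,
  since \<open>p\<^sub>t = - c\<^sup>2 u\<^sub>x\<close> and \<open>p = m\<^sup>2 z\<^bsup>1+d\<^esup>/(d+1)\<close>.
\<close>

definition alpha ::
    "real set \<Rightarrow> (real \<Rightarrow> real \<Rightarrow> real) \<Rightarrow> (real \<Rightarrow> real \<Rightarrow> real) \<Rightarrow> real \<Rightarrow> real \<Rightarrow> real" where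
  "alpha J c p x t = - (dt J p x t - c x t * dx p x t) / (c x t)\<^sup>2"

definition beta ::
    "real set \<Rightarrow> (real \<Rightarrow> real \<Rightarrow> real) \<Rightarrow> (real \<Rightarrow> real \<Rightarrow> real) \<Rightarrow> real \<Rightarrow> real \<Rightarrow> real" where
  "beta J c p x t = - (dt J p x t + c x t * dx p x t) / (c x t)\<^sup>2"

text \<open>
  The sign of \<open>alpha\<close> or \<open>beta\<close> at a point is that of its one-sided limits in \<open>x\<close>; these coincide
  with the value of the function off the exceptional points. For a shock-free solution the two
  limits have the same sign also at a jump of the entropy: there \<open>p\<^sub>t = - c\<^sup>2 u\<^sub>x\<close> holds with both
  one-sided sound speeds while \<open>p\<^sub>t\<close> and \<open>u\<^sub>x\<close> are continuous, so \<open>p\<^sub>t = u\<^sub>x = 0\<close>.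
\<close>

definition pos_at :: "(real \<Rightarrow> real \<Rightarrow> real) \<Rightarrow> real \<Rightarrow> real \<Rightarrow> bool" where
  "pos_at f x t \<longleftrightarrow> (\<forall>F\<in>{at_left x, at_right x}. Lim F (\<lambda>y. f y t) > 0)"

definition neg_at :: "(real \<Rightarrow> real \<Rightarrow> real) \<Rightarrow> real \<Rightarrow> real \<Rightarrow> bool" where
  "neg_at f x t \<longleftrightarrow> (\<forall>F\<in>{at_left x, at_right x}. Lim F (\<lambda>y. f y t) < 0)"

definition forward_R ::
    "real set \<Rightarrow> (real \<Rightarrow> real \<Rightarrow> real) \<Rightarrow> (real \<Rightarrow> real \<Rightarrow> real) \<Rightarrow> real \<Rightarrow> real \<Rightarrow> bool" where
  "forward_R J c p = pos_at (alpha J c p)"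

definition forward_C ::
    "real set \<Rightarrow> (real \<Rightarrow> real \<Rightarrow> real) \<Rightarrow> (real \<Rightarrow> real \<Rightarrow> real) \<Rightarrow> real \<Rightarrow> real \<Rightarrow> bool" where
  "forward_C J c p = neg_at (alpha J c p)"

definition backward_R ::
    "real set \<Rightarrow> (real \<Rightarrow> real \<Rightarrow> real) \<Rightarrow> (real \<Rightarrow> real \<Rightarrow> real) \<Rightarrow> real \<Rightarrow> real \<Rightarrow> bool" where
  "backward_R J c p = pos_at (beta J c p)"

definition backward_C ::
    "real set \<Rightarrow> (real \<Rightarrow> real \<Rightarrow> real) \<Rightarrow> (real \<Rightarrow> real \<Rightarrow> real) \<Rightarrow> real \<Rightarrow> real \<Rightarrow> bool" where
  "backward_C J c p = neg_at (beta J c p)"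

text \<open>
  A wave is followed in the direction of increasing time. It changes character also if the
  quantity in question only becomes zero.
\<close>

definition changes_character ::
    "(real \<Rightarrow> real \<Rightarrow> bool) \<Rightarrow> (real \<Rightarrow> real) \<Rightarrow> real \<Rightarrow> real \<Rightarrow> bool" where
  "changes_character P X t\<^sub>0 t\<^sub>1 \<longleftrightarrow> P (X t\<^sub>0) t\<^sub>0 \<and> (\<exists>t\<in>{t\<^sub>0..t\<^sub>1}. \<not> P (X t) t)"

definition crosses ::
    "(real \<Rightarrow> real \<Rightarrow> bool) \<Rightarrow> (real \<Rightarrow> real) \<Rightarrow> real \<Rightarrow> real \<Rightarrow> bool" where
  "crosses P X t\<^sub>0 t\<^sub>1 \<longleftrightarrow> (\<exists>t\<in>{t\<^sub>0..t\<^sub>1}. P (X t) t)"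

end

(*
  Write W = c^2 alpha = c p_x - p_t for forward waves and W* = c^2 beta = - c p_x - p_t for backward
  ones. The sound speed is c = c0 exp(-k S) p^kappa, and along a forward characteristic, away from
  the exceptional points, W' = a W + (c k S_x / 2) W*, with a bounded coefficient a. If the source
  term has the sign of W, then W cannot vanish in finite time, by Gronwall's inequality. At a jump
  of the entropy p_t = 0, so that both one-sided values of W are positive multiples of p_x. As X is
  strictly monotone in t, these two facts combine by a continuous induction in t. Backward waves are
  treated at the same time by carrying a sign omega for the direction of propagation.
*)
theory Submission
  imports Defs
begin

section \<open>Functions with continuous partial derivatives\<close>

text \<open>Writing c through p and S, rather than through m and z, confines every jump to the
  factor exp(-k S), because p stays C^2 across the exceptional points. The obstacle is that the
  derivative of W along a characteristic is quadratic in W and W*. The bound on a is needed only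
  locally, shortly before the time to be reached, and there it follows from one-sided limits. Each
  discontinuous field therefore gets a trace for either side of a point: a wave of direction omega
  arrives with the trace on the side -omega and leaves with the one on the side omega.\<close>

lemma has_partials_onD:
  assumes "has_partials_on I J f fx ft" "x \<in> I" "t \<in> J"
  shows "((\<lambda>y. f y t) has_real_derivative fx x t) (at x)"
    and "((\<lambda>s. f x s) has_real_derivative ft x t) (at t within J)"
  using assms by (auto simp: has_partials_on_def)

lemma has_partials_on_interiorD:
  assumes "has_partials_on I J f fx ft" "x \<in> I" "t \<in> interior J"
  shows "((\<lambda>s. f x s) has_real_derivative ft x t) (at t)"
  using has_partials_onD(2)[OF assms(1,2)] assms(3) interior_subset
  by (metis at_within_interior subsetD)

text \<open>\<open>C2_on\<close> supplies \<open>fxt\<close> and \<open>ftx\<close> as unrelated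
  functions, so their symmetry has to be proved. The second difference over a small square can be
  evaluated by the mean value theorem in either order of the variables, and continuity of both mixed
  partials lets the square shrink.\<close>

lemma mixed_partials_eq:
  assumes I: "open I" "x \<in> I" and t: "t \<in> interior J"
    and f: "has_partials_on I J f fx ft" "has_partials_on I J fx fxx fxt" "has_partials_on I J ft ftx ftt"
    and cont: "continuous_on (I \<times> J) (\<lambda>(x, t). fxt x t)" "continuous_on (I \<times> J) (\<lambda>(x, t). ftx x t)"
  shows "fxt x t = ftx x t"
proof -
  have op: "open (I \<times> interior J)" using I by (intro open_Times) auto
  have xt: "(x, t) \<in> I \<times> interior J" using I t by auto
  have sub: "I \<times> interior J \<subseteq> I \<times> J" using interior_subset by auto
  obtain r where r: "r > 0" "ball (x, t) r \<subseteq> I \<times> interior J"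
    using op xt open_contains_ball by blast
  have close: "\<bar>fxt x t - ftx x t\<bar> < e" if e: "e > 0" for e
  proof -
    have "continuous (at (x, t)) (\<lambda>(x, t). fxt x t)" "continuous (at (x, t)) (\<lambda>(x, t). ftx x t)"
      using cont[THEN continuous_on_subset, OF sub] op xt by (simp_all add: continuous_on_eq_continuous_at)
    then obtain d1 d2 where d: "d1 > 0" "d2 > 0"
      "\<And>q. dist q (x, t) < d1 \<Longrightarrow> dist (case q of (x, t) \<Rightarrow> fxt x t) (fxt x t) < e / 2"
      "\<And>q. dist q (x, t) < d2 \<Longrightarrow> dist (case q of (x, t) \<Rightarrow> ftx x t) (ftx x t) < e / 2"
      using e half_gt_zero[OF e] unfolding continuous_at_eps_delta by (metis case_prod_conv)
    \<comment> \<open>One third of the smallest radius: two points of the square of side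
      \<open>h\<close> differ by at most 2h in the sum norm, which stays below \<open>r\<close>,
      \<open>d1\<close> and \<open>d2\<close>.\<close>
    define h where "h = min r (min d1 d2) / 3"
    have h: "h > 0" "2 * h < r" "2 * h < d1" "2 * h < d2" using r d by (auto simp: h_def min_def)
    have near: "dist (y, s) (x, t) < min r (min d1 d2)" if "x \<le> y" "y \<le> x + h" "t \<le> s" "s \<le> t + h" for y s
    proof -
      have "dist (y, s) (x, t) \<le> \<bar>y - x\<bar> + \<bar>s - t\<bar>"
        by (simp add: dist_Pair_Pair dist_real_def sqrt_sum_squares_le_sum_abs)
      also have "\<dots> \<le> 2 * h" using that by auto
      also have "\<dots> < min r (min d1 d2)" using h by auto
      finally show ?thesis .
    qed
    have inn: "y \<in> I" "s \<in> interior J" "s \<in> J"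
      if "x \<le> y" "y \<le> x + h" "t \<le> s" "s \<le> t + h" for y s
    proof -
      have "(y, s) \<in> I \<times> interior J" using near[OF that] r by (intro subsetD[OF r(2)]) (auto simp: dist_commute)
      then show "y \<in> I" "s \<in> interior J" "s \<in> J" using interior_subset by auto
    qed
    note box = has_partials_onD(1)[OF f(1) inn(1,3)] has_partials_on_interiorD[OF f(1) inn(1,2)]
      has_partials_on_interiorD[OF f(2) inn(1,2)] has_partials_onD(1)[OF f(3) inn(1,3)]
    have "\<exists>\<xi>>x. \<xi> < x + h \<and> (f (x+h) (t+h) - f (x+h) t) - (f x (t+h) - f x t)
        = (x + h - x) * (fx \<xi> (t+h) - fx \<xi> t)"
      using h
      by (intro MVT2[of x "x + h" "\<lambda>y. f y (t+h) - f y t"]) (auto intro!: DERIV_diff box)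
    then obtain \<xi> where \<xi>: "\<xi> > x" "\<xi> < x + h"
      "(f (x+h) (t+h) - f (x+h) t) - (f x (t+h) - f x t) = h * (fx \<xi> (t+h) - fx \<xi> t)" by auto
    have "\<exists>\<eta>>t. \<eta> < t + h \<and> fx \<xi> (t+h) - fx \<xi> t = (t + h - t) * fxt \<xi> \<eta>"
      using h \<xi> by (intro MVT2) (auto intro!: box)
    then obtain \<eta> where \<eta>: "\<eta> > t" "\<eta> < t + h" "fx \<xi> (t+h) - fx \<xi> t = h * fxt \<xi> \<eta>" by auto
    have "\<exists>\<eta>'>t. \<eta>' < t + h \<and> (f (x+h) (t+h) - f x (t+h)) - (f (x+h) t - f x t)
        = (t + h - t) * (ft (x+h) \<eta>' - ft x \<eta>')"
      using h
      by (intro MVT2[of t "t + h" "\<lambda>s. f (x+h) s - f x s"]) (auto intro!: DERIV_diff box)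
    then obtain \<eta>' where \<eta>': "\<eta>' > t" "\<eta>' < t + h"
      "(f (x+h) (t+h) - f x (t+h)) - (f (x+h) t - f x t) = h * (ft (x+h) \<eta>' - ft x \<eta>')" by auto
    have "\<exists>\<xi>'>x. \<xi>' < x + h \<and> ft (x+h) \<eta>' - ft x \<eta>' = (x + h - x) * ftx \<xi>' \<eta>'"
      using h \<eta>' by (intro MVT2) (auto intro!: box)
    then obtain \<xi>' where \<xi>': "\<xi>' > x" "\<xi>' < x + h" "ft (x+h) \<eta>' - ft x \<eta>' = h * ftx \<xi>' \<eta>'" by auto
    \<comment> \<open>The two groupings of one second difference; cancelling h^2 equates the mixed
      partials at two points near (x, t).\<close>
    have "(f (x+h) (t+h) - f (x+h) t) - (f x (t+h) - f x t)
        = (f (x+h) (t+h) - f x (t+h)) - (f (x+h) t - f x t)" by simp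
    then have "h * (h * fxt \<xi> \<eta>) = h * (h * ftx \<xi>' \<eta>')"
      unfolding \<xi>(3) \<eta>'(3) unfolding \<eta>(3) \<xi>'(3) .
    then have eq: "fxt \<xi> \<eta> = ftx \<xi>' \<eta>'" using h by auto
    have "\<bar>fxt \<xi> \<eta> - fxt x t\<bar> < e / 2"
      using d(3)[of "(\<xi>, \<eta>)"] near[of \<xi> \<eta>] \<xi> \<eta> by (simp add: dist_real_def)
    moreover have "\<bar>ftx \<xi>' \<eta>' - ftx x t\<bar> < e / 2"
      using d(4)[of "(\<xi>', \<eta>')"] near[of \<xi>' \<eta>'] \<xi>' \<eta>' by (simp add: dist_real_def)
    ultimately show ?thesis using eq by linarith
  qed
  show ?thesis
  proof (rule ccontr)
    assume "fxt x t \<noteq> ftx x t"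
    then show False using close[of "\<bar>fxt x t - ftx x t\<bar>"] by auto
  qed
qed

text \<open>A partial in x at the point and a continuous partial in t give joint differentiability;
  the rest is the chain rule for the curve of points (X s, s).\<close>

lemma has_real_derivative_along:
  assumes I: "open I" "X t \<in> I" and t: "t \<in> interior J"
    and f: "has_partials_on I J f fx ft"
    and cont: "continuous_on (I \<times> J) (\<lambda>(x, t). ft x t)"
    and X: "(X has_real_derivative v) (at t)"
  shows "((\<lambda>s. f (X s) s) has_real_derivative fx (X t) t * v + ft (X t) t) (at t)"
proof -
  \<comment> \<open>A ball in time, because \<open>has_derivative_partialsI\<close> asks for a
    convex set in the second variable.\<close>
  obtain r where r: "r > 0" "ball t r \<subseteq> interior J" using t open_contains_ball by blast
  have op: "open (I \<times> ball t r)" using I by (intro open_Times) auto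
  have xt: "(X t, t) \<in> I \<times> ball t r" using I r by auto
  have sub: "I \<times> ball t r \<subseteq> I \<times> J" using interior_subset r by blast
  have "continuous (at (X t, t)) (\<lambda>(x, t). ft x t)"
    using cont[THEN continuous_on_subset, OF sub] op xt by (simp add: continuous_on_eq_continuous_at)
  then have "continuous (at (X t, t) within I \<times> ball t r) (\<lambda>(x, t). ft x t)"
    by (rule continuous_at_imp_continuous_at_within)
  from bounded_linear.continuous[OF bounded_linear_blinfun_scaleR_right this]
  have ct: "continuous (at (X t, t) within I \<times> ball t r)
      (\<lambda>(x, t). blinfun_scaleR_right (ft x t) :: real \<Rightarrow>\<^sub>L real)"
    by (simp add: case_prod_unfold)
  have "((\<lambda>(x, t). f x t) has_derivative (\<lambda>(a, b). fx (X t) t * a + blinfun_scaleR_right (ft (X t) t) b))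
      (at (X t, t) within I \<times> ball t r)"
  proof (rule has_derivative_partialsI[OF _ _ ct])
    show "((\<lambda>x. f x t) has_derivative (*) (fx (X t) t)) (at (X t) within I)"
      using has_partials_onD(1)[OF f I(2)] t interior_subset
      by (auto simp: has_field_derivative_def intro: has_derivative_at_withinI)
    show "(f x has_derivative blinfun_apply (blinfun_scaleR_right (ft x s))) (at s within ball t r)"
      if "x \<in> I" "s \<in> ball t r" for x s
    proof -
      have "s \<in> interior J" using r that by auto
      from has_partials_on_interiorD[OF f that(1) this] show ?thesis
        by (auto simp: has_field_derivative_def intro!: has_derivative_at_withinI
            elim!: has_derivative_eq_rhs)
    qed
  qed (use r in auto)
  then have D: "((\<lambda>(x, t). f x t) has_derivative (\<lambda>(a, b). fx (X t) t * a + ft (X t) t * b)) (at (X t, t))"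
    using at_within_open[OF xt op] by simp
  have "((\<lambda>s. (X s, s)) has_derivative (\<lambda>h. (v * h, h))) (at t)"
    using X by (auto intro!: has_derivative_Pair simp: has_field_derivative_def)
  from has_derivative_compose[OF this D] show ?thesis
    by (auto simp: has_field_derivative_def algebra_simps elim!: has_derivative_eq_rhs)
qed

text \<open>A convex set with interior points lies in the closure of its interior, so even an end
  time in J is a limit point of J. This makes derivatives within J unique, and hence
  \<open>dt\<close> computable, at such a time.\<close>

lemma at_within_nondegenerate_interval_neq_bot:
  fixes J :: "real set"
  assumes "is_interval J" "interior J \<noteq> {}" "t \<in> J"
  shows "at t within J \<noteq> bot"
proof -
  have "convex J" using assms by (simp add: is_interval_convex)
  then have "t \<in> closure (interior J)"
    using assms closure_subset by (metis convex_closure_interior subsetD)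
  moreover have "t islimpt interior J" if "t \<in> interior J"
    using that by (simp add: interior_limit_point)
  ultimately have "t islimpt interior J"
    by (auto simp: closure_def)
  then have "t islimpt J" using islimpt_subset interior_subset by blast
  then show ?thesis by (simp add: trivial_limit_within)
qed

lemma dt_eq:
  assumes "is_interval J" "interior J \<noteq> {}" "t \<in> J"
    and "((\<lambda>s. f x s) has_real_derivative D) (at t within J)"
  shows "dt J f x t = D"
  unfolding dt_def
  using assms at_within_nondegenerate_interval_neq_bot vector_derivative_within
    has_real_derivative_iff_has_vector_derivative by blast

lemma dx_eq: "((\<lambda>y. f y t) has_real_derivative D) (at x) \<Longrightarrow> dx f x t = D"
  by (simp add: dx_def DERIV_imp_deriv)

lemma tendsto_continuous_on_prod:
  assumes "continuous_on (I \<times> J) (\<lambda>(x, t). g x t)" "x \<in> I" "t \<in> J"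
    and "(Y \<longlongrightarrow> x) F" "(T \<longlongrightarrow> t) F" "eventually (\<lambda>s. Y s \<in> I \<and> T s \<in> J) F"
  shows "((\<lambda>s. g (Y s) (T s)) \<longlongrightarrow> g x t) F"
proof -
  have "((\<lambda>s. (\<lambda>(x, t). g x t) (Y s, T s)) \<longlongrightarrow> (\<lambda>(x, t). g x t) (x, t)) F"
    by (rule continuous_on_tendsto_compose[OF assms(1)])
      (use assms in \<open>auto intro: tendsto_Pair elim: eventually_mono\<close>)
  then show ?thesis by simp
qed

section \<open>One-sided limits along curves\<close>

text \<open>A sign replaces the choice between the two one-sided filters: the product of the
  direction of propagation and the direction of time then names the side on which a curve
  approaches.\<close>

definition side :: "real \<Rightarrow> real \<Rightarrow> real filter" where
  "side \<delta> x = at x within {y. \<delta> * (y - x) > 0}"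

lemma side_simps [simp]: "side 1 x = at_right x" "side (-1) x = at_left x"
  by (simp_all add: side_def greaterThan_def lessThan_def)

lemma side_neq_bot: "\<delta> \<in> {1, -1} \<Longrightarrow> side \<delta> x \<noteq> bot"
  by auto

lemma side_le_at: "side \<delta> x \<le> at x"
  by (simp add: side_def at_le)

lemma tendsto_side:
  assumes "filterlim X (side \<delta> x) F"
  shows "(X \<longlongrightarrow> x) F"
  using assms unfolding side_def by (simp add: filterlim_at)

lemma eventually_side_in:
  assumes "open I" "x \<in> I" "finite E"
  shows "\<forall>\<^sub>F y in side \<delta> x. y \<in> I - E"
proof -
  \<comment> \<open>Only the other exceptional points are removed here; x itself may be exceptional
    and is excluded by puncturing the neighbourhood.\<close>
  have "open (I - (E - {x}))" "x \<in> I - (E - {x})"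
    using assms by (auto intro: open_Diff finite_imp_closed)
  then have "\<forall>\<^sub>F y in at x. y \<in> I - (E - {x})"
    by (rule eventually_at_in_open')
  moreover have "\<forall>\<^sub>F y in at x. y \<noteq> x"
    by (simp add: eventually_at_filter)
  ultimately have "\<forall>\<^sub>F y in at x. y \<in> I - E"
    by eventually_elim auto
  then show ?thesis using side_le_at filter_leD by blast
qed

text \<open>The difference quotient has a nonzero limit of sign \<omega>, so multiplying it by s - t
  shows on which side of X t the curve runs. In particular X s differs from X t for s near t, so
  limits in x along one side can be composed with the curve.\<close>

lemma filterlim_side:
  fixes X :: "real \<Rightarrow> real"
  assumes X: "(X has_real_derivative \<omega> * v) (side \<delta> t)" and "v > 0" "\<omega> \<in> {1, -1}" "\<delta> \<in> {1, -1}"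
  shows "filterlim X (side (\<omega> * \<delta>) (X t)) (side \<delta> t)"
proof -
  have lim: "((\<lambda>s. (X s - X t) / (s - t)) \<longlongrightarrow> \<omega> * v) (side \<delta> t)"
    using X by (simp add: side_def has_field_derivative_iff)
  have "((\<lambda>s. \<omega> * ((X s - X t) / (s - t))) \<longlongrightarrow> \<omega> * (\<omega> * v)) (side \<delta> t)"
    by (intro tendsto_intros lim)
  moreover have "\<omega> * (\<omega> * v) > 0" using assms by auto
  ultimately have ev: "\<forall>\<^sub>F s in side \<delta> t. \<omega> * ((X s - X t) / (s - t)) > 0"
    by (rule order_tendstoD)
  have "\<forall>\<^sub>F s in side \<delta> t. \<delta> * (s - t) > 0"
    by (simp add: side_def eventually_at_filter)
  with ev have "\<forall>\<^sub>F s in side \<delta> t. \<omega> * \<delta> * (X s - X t) > 0"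
  proof eventually_elim
    case (elim s)
    then have "(\<omega> * ((X s - X t) / (s - t))) * (\<delta> * (s - t)) > 0" by (rule mult_pos_pos)
    moreover have "(\<omega> * ((X s - X t) / (s - t))) * (\<delta> * (s - t)) = \<omega> * \<delta> * (X s - X t)"
      using elim by (cases "s = t") auto
    ultimately show ?case by simp
  qed
  moreover have "(X \<longlongrightarrow> X t) (side \<delta> t)"
    using DERIV_isCont[of X] X unfolding side_def
    by (metis DERIV_continuous continuous_within)
  ultimately show ?thesis
    unfolding side_def[of "\<omega> * \<delta>"] by (auto simp: filterlim_at elim: eventually_mono)
qed

lemma has_real_derivative_split:
  fixes X :: "real \<Rightarrow> real"
  assumes "(X has_real_derivative v) (at_left t)" "(X has_real_derivative v) (at_right t)"
  shows "(X has_real_derivative v) (at t)"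
  using assms by (simp add: has_field_derivative_iff filterlim_at_split)

section \<open>Continuous induction and a Gronwall bound\<close>

text \<open>At the infimum of the counterexamples, \<open>left\<close> (or \<open>start\<close>)
  gives P, and \<open>right\<close> then carries P strictly beyond that infimum.\<close>

lemma real_interval_induct:
  fixes a b :: real
  assumes start: "P a"
    and right: "\<And>t. a \<le> t \<Longrightarrow> t < b \<Longrightarrow> P t \<Longrightarrow> \<forall>\<^sub>F s in at_right t. P s"
    and left: "\<And>t. a < t \<Longrightarrow> t \<le> b \<Longrightarrow> (\<And>s. a \<le> s \<Longrightarrow> s < t \<Longrightarrow> P s) \<Longrightarrow> P t"
    and t: "a \<le> t" "t \<le> b"
  shows "P t"
proof (rule ccontr)
  assume "\<not> P t"
  define B where "B = {s \<in> {a..b}. \<not> P s}"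
  define i where "i = Inf B"
  have B: "t \<in> B" "bdd_below B" using \<open>\<not> P t\<close> t by (auto simp: B_def)
  have i: "a \<le> i" "i \<le> t"
    unfolding i_def using B by (auto intro!: cInf_greatest cInf_lower simp: B_def)
  have below: "P s" if "a \<le> s" "s < i" for s
  proof (rule ccontr)
    assume "\<not> P s"
    then have "s \<in> B" using that i t by (auto simp: B_def)
    then have "i \<le> s" unfolding i_def using B by (intro cInf_lower)
    then show False using that by simp
  qed
  have Pi: "P i"
    using start left[of i] below i t by (cases "i = a") auto
  then have "i < b" using i t \<open>\<not> P t\<close> by (cases "i = b") auto
  then obtain c where c: "c > i" "\<And>s. i < s \<Longrightarrow> s < c \<Longrightarrow> P s"
    using right[OF i(1) _ Pi] unfolding eventually_at_right_field by blast
  have "s \<ge> c" if "s \<in> B" for s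
  proof -
    have "s \<ge> i" unfolding i_def using B that by (intro cInf_lower)
    then show ?thesis using c that Pi by (cases "s = i") (auto simp: B_def not_less[symmetric])
  qed
  then have "c \<le> i" unfolding i_def using B by (intro cInf_greatest) auto
  then show False using c by simp
qed

text \<open>The integrating factor exp (L t) makes g nondecreasing, so its positive value at r
  bounds the limit from below. The end s enters through a limit because the curve may hit an
  exceptional point at that time.\<close>

lemma gronwall_positive_limit:
  fixes g :: "real \<Rightarrow> real"
  assumes "r < s"
    and g: "\<And>t. r \<le> t \<Longrightarrow> t < s \<Longrightarrow> (g has_real_derivative a t * g t + b t) (at t)"
    and pos: "\<And>t. r \<le> t \<Longrightarrow> t < s \<Longrightarrow> g t > 0"
    and b: "\<And>t. r \<le> t \<Longrightarrow> t < s \<Longrightarrow> b t \<ge> 0"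
    and a: "\<And>t. r \<le> t \<Longrightarrow> t < s \<Longrightarrow> a t \<ge> - L"
    and lim: "(g \<longlongrightarrow> l) (at_left s)"
  shows "l > 0"
proof -
  have mono: "g r * exp (L * r) \<le> g t * exp (L * t)" if "r \<le> t" "t < s" for t
  proof (rule DERIV_nonneg_imp_nondecreasing[OF that(1)])
    fix x assume x: "r \<le> x" "x \<le> t"
    have "((\<lambda>t. g t * exp (L * t)) has_real_derivative ((a x + L) * g x + b x) * exp (L * x)) (at x)"
      using x that by (auto intro!: derivative_eq_intros g simp: algebra_simps)
    moreover have "(a x + L) * g x \<ge> 0"
      using a[of x] pos[of x] x that by (intro mult_nonneg_nonneg) auto
    ultimately show "\<exists>y. ((\<lambda>t. g t * exp (L * t)) has_real_derivative y) (at x) \<and> 0 \<le> y"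
      using b[of x] x that by (intro exI[of _ "((a x + L) * g x + b x) * exp (L * x)"] conjI) auto
  qed
  have "((\<lambda>t. g t * exp (L * t)) \<longlongrightarrow> l * exp (L * s)) (at_left s)"
    by (intro tendsto_intros lim)
  moreover have "\<forall>\<^sub>F t in at_left s. g r * exp (L * r) \<le> g t * exp (L * t)"
    unfolding eventually_at_left_field using mono \<open>r < s\<close> by (auto intro!: exI[of _ r])
  ultimately have "g r * exp (L * r) \<le> l * exp (L * s)"
    by (intro tendsto_lowerbound) auto
  moreover have "g r * exp (L * r) > 0" using pos[of r] \<open>r < s\<close> by simp
  ultimately have "l * exp (L * s) > 0" by linarith
  then show ?thesis by (simp add: zero_less_mult_iff)
qed

section \<open>Transport along characteristics\<close>

text \<open>The gas enters through the form of the sound speed, the relation between p_t and u_x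
  that combines mass conservation with the pressure law, and the momentum equation.
  \<open>S\<^sub>\<delta>\<close> and \<open>S'\<^sub>\<delta>\<close> are the traces of S and S' on
  the side of sign \<delta>.\<close>

locale acoustic_field =
  fixes I J E :: "real set"
    and p p\<^sub>x p\<^sub>t p\<^sub>x\<^sub>x p\<^sub>x\<^sub>t p\<^sub>t\<^sub>x p\<^sub>t\<^sub>t u u\<^sub>x u\<^sub>t u\<^sub>x\<^sub>x u\<^sub>x\<^sub>t u\<^sub>t\<^sub>x u\<^sub>t\<^sub>t :: "real \<Rightarrow> real \<Rightarrow> real"
    and S S' :: "real \<Rightarrow> real" and S\<^sub>\<delta> S'\<^sub>\<delta> :: "real \<Rightarrow> real \<Rightarrow> real" and c\<^sub>0 k \<kappa> :: real
  assumes open_I: "open I" and finite_E: "finite E" and pos: "c\<^sub>0 > 0" "k > 0"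
    and p: "has_partials_on I J p p\<^sub>x p\<^sub>t" "has_partials_on I J p\<^sub>x p\<^sub>x\<^sub>x p\<^sub>x\<^sub>t"
      "has_partials_on I J p\<^sub>t p\<^sub>t\<^sub>x p\<^sub>t\<^sub>t"
    and u: "has_partials_on I J u u\<^sub>x u\<^sub>t" "has_partials_on I J u\<^sub>x u\<^sub>x\<^sub>x u\<^sub>x\<^sub>t"
      "has_partials_on I J u\<^sub>t u\<^sub>t\<^sub>x u\<^sub>t\<^sub>t"
    and cont: "\<And>g. g \<in> {p, p\<^sub>x, p\<^sub>t, p\<^sub>x\<^sub>t, p\<^sub>t\<^sub>x, p\<^sub>t\<^sub>t, u\<^sub>x, u\<^sub>x\<^sub>t, u\<^sub>t\<^sub>x} \<Longrightarrow> continuous_on (I \<times> J) (\<lambda>(x, t). g x t)"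
    and p_pos: "\<And>x t. x \<in> I \<Longrightarrow> t \<in> J \<Longrightarrow> p x t > 0"
    and S: "\<And>x. x \<in> I - E \<Longrightarrow> (S has_real_derivative S' x) (at x)"
    and S_lim: "\<And>\<delta> x. \<delta> \<in> {1, -1} \<Longrightarrow> x \<in> I \<Longrightarrow> (S \<longlongrightarrow> S\<^sub>\<delta> \<delta> x) (side \<delta> x)"
    and S'_lim: "\<And>\<delta> x. \<delta> \<in> {1, -1} \<Longrightarrow> x \<in> I \<Longrightarrow> (S' \<longlongrightarrow> S'\<^sub>\<delta> \<delta> x) (side \<delta> x)"
    and p\<^sub>t_eq: "\<And>x t. x \<in> I - E \<Longrightarrow> t \<in> J \<Longrightarrow>
      p\<^sub>t x t = - (c\<^sub>0 * exp (- k * S x) * p x t powr \<kappa>)\<^sup>2 * u\<^sub>x x t"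
    and u\<^sub>t_eq: "\<And>x t. x \<in> I - E \<Longrightarrow> t \<in> J \<Longrightarrow> u\<^sub>t x t = - p\<^sub>x x t"
begin

definition c :: "real \<Rightarrow> real \<Rightarrow> real" where
  "c x t = c\<^sub>0 * exp (- k * S x) * p x t powr \<kappa>"

text \<open>The pressure is continuous, so the side matters only through the entropy. In
  \<open>W\<^sub>\<delta>\<close> it likewise matters only through this speed.\<close>

definition c\<^sub>\<delta> :: "real \<Rightarrow> real \<Rightarrow> real \<Rightarrow> real" where
  "c\<^sub>\<delta> \<delta> x t = c\<^sub>0 * exp (- k * S\<^sub>\<delta> \<delta> x) * p x t powr \<kappa>"

definition W :: "real \<Rightarrow> real \<Rightarrow> real \<Rightarrow> real" where
  "W \<omega> x t = \<omega> * c x t * p\<^sub>x x t - p\<^sub>t x t"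

definition W\<^sub>\<delta> :: "real \<Rightarrow> real \<Rightarrow> real \<Rightarrow> real \<Rightarrow> real" where
  "W\<^sub>\<delta> \<omega> \<delta> x t = \<omega> * c\<^sub>\<delta> \<delta> x t * p\<^sub>x x t - p\<^sub>t x t"

lemma c_pos: "x \<in> I \<Longrightarrow> t \<in> J \<Longrightarrow> c x t > 0" and c\<delta>_pos: "x \<in> I \<Longrightarrow> t \<in> J \<Longrightarrow> c\<^sub>\<delta> \<delta> x t > 0"
  using pos p_pos[of x t] by (auto simp: c_def c\<^sub>\<delta>_def)

lemma S\<delta>_eq:
  assumes "x \<in> I - E" "\<delta> \<in> {1, -1}"
  shows "S\<^sub>\<delta> \<delta> x = S x"
proof -
  have "(S \<longlongrightarrow> S x) (at x)" using S[OF assms(1)] DERIV_isCont isContD by blast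
  then have "(S \<longlongrightarrow> S x) (side \<delta> x)" using side_le_at tendsto_mono by blast
  moreover have "(S \<longlongrightarrow> S\<^sub>\<delta> \<delta> x) (side \<delta> x)" using S_lim assms by auto
  ultimately show ?thesis using side_neq_bot[OF assms(2)] tendsto_unique by blast
qed

lemma c\<delta>_eq: "x \<in> I - E \<Longrightarrow> \<delta> \<in> {1, -1} \<Longrightarrow> c\<^sub>\<delta> \<delta> x t = c x t"
  and W\<delta>_eq: "x \<in> I - E \<Longrightarrow> \<delta> \<in> {1, -1} \<Longrightarrow> W\<^sub>\<delta> \<omega> \<delta> x t = W \<omega> x t"
  by (simp_all add: c_def c\<^sub>\<delta>_def W_def W\<^sub>\<delta>_def S\<delta>_eq)

text \<open>The filter F is arbitrary so that one statement serves both for limits in space at a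
  fixed time and for limits in time along a characteristic.\<close>

lemma
  assumes "x \<in> I" "t \<in> J" "\<delta> \<in> {1, -1}"
    and X: "filterlim X (side \<delta> x) F" and T: "(T \<longlongrightarrow> t) F" "\<forall>\<^sub>F s in F. T s \<in> J"
  shows tendsto_p: "((\<lambda>s. p (X s) (T s)) \<longlongrightarrow> p x t) F"
    and tendsto_c: "((\<lambda>s. c (X s) (T s)) \<longlongrightarrow> c\<^sub>\<delta> \<delta> x t) F"
    and tendsto_W: "((\<lambda>s. W \<omega> (X s) (T s)) \<longlongrightarrow> W\<^sub>\<delta> \<omega> \<delta> x t) F"
    and tendsto_S': "((\<lambda>s. S' (X s)) \<longlongrightarrow> S'\<^sub>\<delta> \<delta> x) F"
    and eventually_I: "\<forall>\<^sub>F s in F. X s \<in> I - E"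
proof -
  show ev: "\<forall>\<^sub>F s in F. X s \<in> I - E"
    using eventually_side_in[OF open_I \<open>x \<in> I\<close> finite_E] X by (rule eventually_compose_filterlim)
  have ev': "\<forall>\<^sub>F s in F. X s \<in> I \<and> T s \<in> J"
    using ev T(2) by eventually_elim auto
  note lim = tendsto_continuous_on_prod[OF _ assms(1,2) tendsto_side[OF X] T(1) ev']
  show p: "((\<lambda>s. p (X s) (T s)) \<longlongrightarrow> p x t) F" by (rule lim) (auto intro: cont)
  show c: "((\<lambda>s. c (X s) (T s)) \<longlongrightarrow> c\<^sub>\<delta> \<delta> x t) F"
    unfolding c_def c\<^sub>\<delta>_def using p_pos[OF assms(1,2)]
    by (intro tendsto_intros p filterlim_compose[OF S_lim[OF assms(3,1)] X]) auto
  show "((\<lambda>s. W \<omega> (X s) (T s)) \<longlongrightarrow> W\<^sub>\<delta> \<omega> \<delta> x t) F"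
    unfolding W_def W\<^sub>\<delta>_def by (intro tendsto_intros c lim cont) auto
  show "((\<lambda>s. S' (X s)) \<longlongrightarrow> S'\<^sub>\<delta> \<delta> x) F"
    by (rule filterlim_compose[OF S'_lim[OF assms(3,1)] X])
qed

text \<open>The relation off the exceptional set passes to the limit from either side:
  \<open>p\<^sub>t\<close> and \<open>u\<^sub>x\<close> are continuous, and only the sound speed
  remembers the side.\<close>

lemma contact:
  assumes "x \<in> I" "t \<in> J" "\<delta> \<in> {1, -1}"
  shows "p\<^sub>t x t = - (c\<^sub>\<delta> \<delta> x t)\<^sup>2 * u\<^sub>x x t"
proof (rule tendsto_unique[OF side_neq_bot[OF assms(3)]])
  have X: "filterlim (\<lambda>y. y) (side \<delta> x) (side \<delta> x)" by (rule filterlim_ident)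
  have T: "((\<lambda>y. t) \<longlongrightarrow> t) (side \<delta> x)" "\<forall>\<^sub>F y in side \<delta> x. t \<in> J" using assms by auto
  note ev = eventually_I[OF assms X T]
  have ev': "\<forall>\<^sub>F y in side \<delta> x. y \<in> I \<and> t \<in> J" using ev by eventually_elim (use assms in auto)
  note lim = tendsto_continuous_on_prod[OF cont assms(1,2) tendsto_side[OF X] T(1) ev']
  show "((\<lambda>y. p\<^sub>t y t) \<longlongrightarrow> p\<^sub>t x t) (side \<delta> x)" by (rule lim) auto
  have "((\<lambda>y. - (c y t)\<^sup>2 * u\<^sub>x y t) \<longlongrightarrow> - (c\<^sub>\<delta> \<delta> x t)\<^sup>2 * u\<^sub>x x t) (side \<delta> x)"
    by (intro tendsto_intros tendsto_c[OF assms X T] lim) auto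
  moreover have "\<forall>\<^sub>F y in side \<delta> x. - (c y t)\<^sup>2 * u\<^sub>x y t = p\<^sub>t y t"
    using ev by eventually_elim (use assms in \<open>simp add: c_def p\<^sub>t_eq\<close>)
  ultimately show "((\<lambda>y. p\<^sub>t y t) \<longlongrightarrow> - (c\<^sub>\<delta> \<delta> x t)\<^sup>2 * u\<^sub>x x t) (side \<delta> x)"
    by (rule Lim_transform_eventually)
qed

text \<open>
  Where the entropy jumps, \<open>p\<^sub>t\<close> vanishes, so that both traces of \<open>W\<close> are positive multiples of
  \<open>\<omega> p\<^sub>x\<close>.
\<close>

lemma W\<delta>_sign:
  assumes "x \<in> I" "t \<in> J" "\<delta> \<in> {1, -1}" "\<delta>' \<in> {1, -1}" "\<sigma> * W\<^sub>\<delta> \<omega> \<delta> x t > 0"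
  shows "\<sigma> * W\<^sub>\<delta> \<omega> \<delta>' x t > 0"
proof (cases "c\<^sub>\<delta> \<delta> x t = c\<^sub>\<delta> \<delta>' x t")
  case True
  then show ?thesis using assms by (simp add: W\<^sub>\<delta>_def)
next
  case False
  have pos: "c\<^sub>\<delta> \<delta> x t > 0" "c\<^sub>\<delta> \<delta>' x t > 0" using c\<delta>_pos assms by auto
  have 1: "p\<^sub>t x t = - (c\<^sub>\<delta> \<delta> x t)\<^sup>2 * u\<^sub>x x t" and "p\<^sub>t x t = - (c\<^sub>\<delta> \<delta>' x t)\<^sup>2 * u\<^sub>x x t"
    by (fact contact[OF assms(1-3)], fact contact[OF assms(1,2,4)])
  then have "(c\<^sub>\<delta> \<delta> x t)\<^sup>2 = (c\<^sub>\<delta> \<delta>' x t)\<^sup>2 \<or> u\<^sub>x x t = 0"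
    by (metis minus_mult_left mult_right_cancel neg_equal_iff_equal)
  then have "u\<^sub>x x t = 0" using False pos by (simp add: power2_eq_iff_nonneg)
  then have "p\<^sub>t x t = 0" using 1 by simp
  then have W: "W\<^sub>\<delta> \<omega> \<epsilon> x t = \<omega> * p\<^sub>x x t * c\<^sub>\<delta> \<epsilon> x t" for \<epsilon> by (simp add: W\<^sub>\<delta>_def)
  have "\<sigma> * (\<omega> * p\<^sub>x x t) > 0"
    using assms(5) pos(1) unfolding W mult.assoc[symmetric] by (rule zero_less_mult_pos2)
  from mult_pos_pos[OF this pos(2)] show ?thesis by (simp only: W mult.assoc)
qed

section \<open>The wave equation for the pressure and the transport equation for W\<close>

text \<open>At fixed x the entropy is constant in time, so the time derivative of c^2 in p_t = -c^2
  u_x acts on the pressure factor only. The momentum equation gives u_xt = u_tx = -p_xx, and the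
  remaining c^2 u_x is turned back into -p_t, which makes the nonlinear term quadratic in
  p_t.\<close>

lemma wave:
  assumes x: "x \<in> I - E" and t: "t \<in> interior J"
  shows "p\<^sub>t\<^sub>t x t = (c x t)\<^sup>2 * p\<^sub>x\<^sub>x x t + 2 * \<kappa> * (p\<^sub>t x t)\<^sup>2 / p x t"
proof -
  have xI: "x \<in> I" and tJ: "t \<in> J" using x t interior_subset by auto
  have "open (I - E)" using open_I finite_E by (intro open_Diff finite_imp_closed)
  have P: "p x t > 0" using p_pos xI tJ .
  have "u\<^sub>x\<^sub>t x t = u\<^sub>t\<^sub>x x t"
    by (rule mixed_partials_eq[OF open_I xI t u]) (auto intro: cont)
  moreover have "u\<^sub>t\<^sub>x x t = - p\<^sub>x\<^sub>x x t"
  proof (rule DERIV_unique)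
    show "((\<lambda>y. u\<^sub>t y t) has_real_derivative u\<^sub>t\<^sub>x x t) (at x)"
      by (rule has_partials_onD(1)[OF u(3) xI tJ])
    have "((\<lambda>y. - p\<^sub>x y t) has_real_derivative - p\<^sub>x\<^sub>x x t) (at x)"
      by (rule DERIV_minus[OF has_partials_onD(1)[OF p(2) xI tJ]])
    then show "((\<lambda>y. u\<^sub>t y t) has_real_derivative - p\<^sub>x\<^sub>x x t) (at x)"
      by (rule has_field_derivative_transform_within_open[OF _ \<open>open (I - E)\<close> x]) (use u\<^sub>t_eq tJ in auto)
  qed
  ultimately have uxt: "u\<^sub>x\<^sub>t x t = - p\<^sub>x\<^sub>x x t" by simp
  define A where "A = (c\<^sub>0 * exp (- k * S x))\<^sup>2"
  have c2: "(c x s)\<^sup>2 = A * (p x s powr \<kappa>)\<^sup>2" for s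
    by (simp add: A_def c_def power_mult_distrib)
  have "((\<lambda>s. p x s powr \<kappa>) has_real_derivative p x t powr \<kappa> * (\<kappa> * p\<^sub>t x t / p x t)) (at t)"
    using DERIV_powr[OF has_partials_on_interiorD[OF p(1) xI t] P DERIV_const[of \<kappa>]] by (simp add: mult_ac)
  from DERIV_power[OF this, of 2]
  have "((\<lambda>s. - (c x s)\<^sup>2 * u\<^sub>x x s) has_real_derivative
      - (c x t)\<^sup>2 * (2 * \<kappa> * p\<^sub>t x t / p x t) * u\<^sub>x x t + - (c x t)\<^sup>2 * u\<^sub>x\<^sub>t x t) (at t)"
    unfolding c2
    by (intro DERIV_cong[OF DERIV_mult[OF DERIV_minus[OF DERIV_cmult] has_partials_on_interiorD[OF u(2) xI t]]])
      (assumption, simp add: power2_eq_square algebra_simps)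
  then have "(p\<^sub>t x has_real_derivative
      - (c x t)\<^sup>2 * (2 * \<kappa> * p\<^sub>t x t / p x t) * u\<^sub>x x t + - (c x t)\<^sup>2 * u\<^sub>x\<^sub>t x t) (at t)"
    by (rule has_field_derivative_transform_within_open[OF _ open_interior t])
      (use p\<^sub>t_eq[OF x] interior_subset[of J] in \<open>auto simp: c_def\<close>)
  from DERIV_unique[OF has_partials_on_interiorD[OF p(3) xI t] this]
  have "p\<^sub>t\<^sub>t x t = - (c x t)\<^sup>2 * u\<^sub>x x t * (2 * \<kappa> * p\<^sub>t x t / p x t) + (c x t)\<^sup>2 * p\<^sub>x\<^sub>x x t"
    unfolding uxt by (simp add: mult_ac)
  also have "- (c x t)\<^sup>2 * u\<^sub>x x t = p\<^sub>t x t" using p\<^sub>t_eq[OF x tJ] by (simp add: c_def)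
  finally show ?thesis by (simp add: power2_eq_square)
qed

text \<open>The cofactor of W in the transport equation. It contains W and W* themselves, which is
  harmless: along a given solution only a local lower bound for it is required.\<close>

definition damping :: "real \<Rightarrow> real \<Rightarrow> real \<Rightarrow> real" where
  "damping \<omega> x t = - \<kappa> / (2 * p x t) * (W \<omega> x t + 3 * W (- \<omega>) x t) - \<omega> * c x t * k * S' x / 2"

lemma W_along_characteristic:
  assumes x: "X t \<in> I - E" and t: "t \<in> interior J" and \<omega>: "\<omega> \<in> {1, -1}"
    and X: "(X has_real_derivative \<omega> * c (X t) t) (at t)"
  shows "((\<lambda>s. W \<omega> (X s) s) has_real_derivative
           damping \<omega> (X t) t * W \<omega> (X t) t + \<omega> * c (X t) t * k * S' (X t) / 2 * W (- \<omega>) (X t) t) (at t)"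
proof -
  have xI: "X t \<in> I" and tJ: "t \<in> J" using x t interior_subset by auto
  define C P Px Pt s where "C = c (X t) t" and "P = p (X t) t" and "Px = p\<^sub>x (X t) t" and "Pt = p\<^sub>t (X t) t"
    and "s = S' (X t)"
  have P: "P > 0" using p_pos xI tJ by (simp add: P_def)
  have mixed: "p\<^sub>x\<^sub>t (X t) t = p\<^sub>t\<^sub>x (X t) t"
    by (rule mixed_partials_eq[OF open_I xI t p]) (auto intro: cont)
  note along = has_real_derivative_along[OF open_I xI t _ _ X]
  have Dp: "((\<lambda>s. p (X s) s) has_real_derivative Px * (\<omega> * C) + Pt) (at t)"
    using along[OF p(1) cont] by (simp add: C_def Px_def Pt_def)
  have Dpx: "((\<lambda>s. p\<^sub>x (X s) s) has_real_derivative p\<^sub>x\<^sub>x (X t) t * (\<omega> * C) + p\<^sub>x\<^sub>t (X t) t) (at t)"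
    using along[OF p(2) cont] by (simp add: C_def)
  have Dpt: "((\<lambda>s. p\<^sub>t (X s) s) has_real_derivative p\<^sub>x\<^sub>t (X t) t * (\<omega> * C) + p\<^sub>t\<^sub>t (X t) t) (at t)"
    using along[OF p(3) cont] mixed by (simp add: C_def)
  have DS: "((\<lambda>r. S (X r)) has_real_derivative s * (\<omega> * C)) (at t)"
    using DERIV_chain2[OF S[OF x] X] by (simp add: s_def C_def)
  have Dc: "((\<lambda>s. c (X s) s) has_real_derivative C * (\<kappa> * (Px * (\<omega> * C) + Pt) / P - k * s * (\<omega> * C))) (at t)"
  proof -
    have "((\<lambda>s. p (X s) s powr \<kappa>) has_real_derivative P powr \<kappa> * (\<kappa> * (Px * (\<omega> * C) + Pt) / P)) (at t)"
      using DERIV_powr[OF Dp _ DERIV_const[of \<kappa>]] P by (simp add: P_def mult_ac)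
    moreover have DE: "((\<lambda>r. c\<^sub>0 * exp (- k * S (X r))) has_real_derivative
        c\<^sub>0 * exp (- k * S (X t)) * (- k * (s * (\<omega> * C)))) (at t)"
      by (auto intro!: derivative_eq_intros DS)
    ultimately show ?thesis
      unfolding c_def by (intro DERIV_cong[OF DERIV_mult[OF DE]])
        (assumption, simp add: C_def c_def P_def algebra_simps)
  qed
  have wave: "p\<^sub>t\<^sub>t (X t) t = C\<^sup>2 * p\<^sub>x\<^sub>x (X t) t + 2 * \<kappa> * Pt\<^sup>2 / P"
    using wave[OF x t] by (simp add: C_def Pt_def P_def)
  have W: "W \<omega> (X t) t = \<omega> * C * Px - Pt" "W (- \<omega>) (X t) t = - \<omega> * C * Px - Pt"
    by (simp_all add: W_def C_def Px_def Pt_def)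
  have d: "damping \<omega> (X t) t
      = - \<kappa> / (2 * P) * ((\<omega> * C * Px - Pt) + 3 * (- \<omega> * C * Px - Pt)) - \<omega> * C * k * s / 2"
    unfolding damping_def W by (simp add: C_def P_def s_def)
  have "((\<lambda>s. W \<omega> (X s) s) has_real_derivative
      \<omega> * (C * (\<kappa> * (Px * (\<omega> * C) + Pt) / P - k * s * (\<omega> * C)) * Px
        + C * (p\<^sub>x\<^sub>x (X t) t * (\<omega> * C) + p\<^sub>x\<^sub>t (X t) t))
      - (p\<^sub>x\<^sub>t (X t) t * (\<omega> * C) + p\<^sub>t\<^sub>t (X t) t)) (at t)"
    unfolding W_def
    by (auto intro!: derivative_eq_intros Dc Dpx Dpt simp: C_def Px_def algebra_simps)
  moreover have "\<omega> * (C * (\<kappa> * (Px * (\<omega> * C) + Pt) / P - k * s * (\<omega> * C)) * Px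
        + C * (p\<^sub>x\<^sub>x (X t) t * (\<omega> * C) + p\<^sub>x\<^sub>t (X t) t))
      - (p\<^sub>x\<^sub>t (X t) t * (\<omega> * C) + p\<^sub>t\<^sub>t (X t) t)
    = damping \<omega> (X t) t * W \<omega> (X t) t + \<omega> * c (X t) t * k * S' (X t) / 2 * W (- \<omega>) (X t) t"
    unfolding d W wave C_def[symmetric] s_def[symmetric]
    using P \<omega> by (auto simp: field_simps power2_eq_square)
  ultimately show ?thesis by simp
qed

section \<open>Persistence of the sign of W along a characteristic\<close>

text \<open>The invariant is stated for the trace on the side \<omega>, into which the curve moves
  next: there positivity spreads to slightly later times by continuity. Arrival at a time yields the
  trace on the side -\<omega>, and \<open>W\<delta>_sign\<close> carries its sign across.\<close>

lemma W_sign_persists: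
  assumes J: "{t\<^sub>0..t\<^sub>1} \<subseteq> J" and XI: "X ` {t\<^sub>0..t\<^sub>1} \<subseteq> I" and \<omega>: "\<omega> \<in> {1, -1}"
    and right: "\<And>t. t \<in> {t\<^sub>0..<t\<^sub>1} \<Longrightarrow> (X has_real_derivative \<omega> * c\<^sub>\<delta> \<omega> (X t) t) (at_right t)"
    and left: "\<And>t. t \<in> {t\<^sub>0<..t\<^sub>1} \<Longrightarrow> (X has_real_derivative \<omega> * c\<^sub>\<delta> (- \<omega>) (X t) t) (at_left t)"
    and source: "\<And>t. t \<in> {t\<^sub>0..t\<^sub>1} \<Longrightarrow> X t \<notin> E \<Longrightarrow> \<sigma> * (\<omega> * S' (X t) * W (- \<omega>) (X t) t) \<ge> 0"
    and start: "\<sigma> * W\<^sub>\<delta> \<omega> \<omega> (X t\<^sub>0) t\<^sub>0 > 0"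
    and t: "t\<^sub>0 \<le> t" "t \<le> t\<^sub>1"
  shows "\<sigma> * W\<^sub>\<delta> \<omega> \<omega> (X t) t > 0"
proof -
  have I: "X t \<in> I" and tJ: "t \<in> J" if "t\<^sub>0 \<le> t" "t \<le> t\<^sub>1" for t using that XI J by auto
  have \<omega>': "- \<omega> \<in> {1, -1}" using \<omega> by auto
  show ?thesis
  proof (rule real_interval_induct[of "\<lambda>t. \<sigma> * W\<^sub>\<delta> \<omega> \<omega> (X t) t > 0", OF start _ _ t])
    fix t assume t: "t\<^sub>0 \<le> t" "t < t\<^sub>1" and W: "\<sigma> * W\<^sub>\<delta> \<omega> \<omega> (X t) t > 0"
    have x: "X t \<in> I" "t \<in> J" using I tJ t by auto
    have "filterlim X (side (\<omega> * 1) (X t)) (side 1 t)"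
      by (rule filterlim_side[OF _ c\<delta>_pos[OF x] \<omega>]) (use right t in auto)
    then have X: "filterlim X (side \<omega> (X t)) (at_right t)" by simp
    have "\<forall>\<^sub>F s in at_right t. s < t\<^sub>1" using t by (simp add: eventually_at_right_field) blast
    then have evJ: "\<forall>\<^sub>F s in at_right t. s \<in> J"
      using eventually_at_right_less[of t] by eventually_elim (use J t in auto)
    note hyps = x \<omega> X tendsto_ident_at evJ
    have "((\<lambda>s. \<sigma> * W \<omega> (X s) s) \<longlongrightarrow> \<sigma> * W\<^sub>\<delta> \<omega> \<omega> (X t) t) (at_right t)"
      by (intro tendsto_mult tendsto_const tendsto_W[OF hyps])
    from order_tendstoD(1)[OF this W] eventually_I[OF hyps]
    show "\<forall>\<^sub>F s in at_right t. \<sigma> * W\<^sub>\<delta> \<omega> \<omega> (X s) s > 0"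
      by eventually_elim (use \<omega> in \<open>simp add: W\<delta>_eq\<close>)
  next
    fix t assume t: "t\<^sub>0 < t" "t \<le> t\<^sub>1" and before: "\<And>s. t\<^sub>0 \<le> s \<Longrightarrow> s < t \<Longrightarrow> \<sigma> * W\<^sub>\<delta> \<omega> \<omega> (X s) s > 0"
    have x: "X t \<in> I" "t \<in> J" using I tJ t by auto
    have "filterlim X (side (\<omega> * (-1)) (X t)) (side (-1) t)"
      by (rule filterlim_side[OF _ c\<delta>_pos[OF x] \<omega>]) (use left t in auto)
    then have X: "filterlim X (side (- \<omega>) (X t)) (at_left t)" by simp
    have ev0: "\<forall>\<^sub>F s in at_left t. t\<^sub>0 < s" using t by (simp add: eventually_at_left_field) blast
    then have evJ: "\<forall>\<^sub>F s in at_left t. s \<in> J"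
      unfolding eventually_at_left_field using J t by (auto intro!: exI[of _ t\<^sub>0])
    note hyps = x \<omega>' X tendsto_ident_at evJ
    \<comment> \<open>The damping has a limit from the left even if X t is exceptional. Hence it is
      bounded below shortly before t, and 1 - ?l serves as Gronwall constant.\<close>
    have "p (X t) t \<noteq> 0" using p_pos[OF x] by simp
    then have "((\<lambda>s. damping \<omega> (X s) s) \<longlongrightarrow> - \<kappa> / (2 * p (X t) t) *
        (W\<^sub>\<delta> \<omega> (- \<omega>) (X t) t + 3 * W\<^sub>\<delta> (- \<omega>) (- \<omega>) (X t) t)
        - \<omega> * c\<^sub>\<delta> (- \<omega>) (X t) t * k * S'\<^sub>\<delta> (- \<omega>) (X t) / 2) (at_left t)" (is "(_ \<longlongrightarrow> ?l) _")
      unfolding damping_def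
      by (intro tendsto_intros tendsto_p[OF hyps] tendsto_W[OF hyps] tendsto_c[OF hyps] tendsto_S'[OF hyps]) auto
    then have "\<forall>\<^sub>F s in at_left t. damping \<omega> (X s) s > ?l - 1"
      by (rule order_tendstoD) simp
    with eventually_I[OF hyps] ev0
    have "\<forall>\<^sub>F s in at_left t. X s \<in> I - E \<and> t\<^sub>0 < s \<and> damping \<omega> (X s) s \<ge> - (1 - ?l)"
      by eventually_elim auto
    then obtain r\<^sub>0 where r\<^sub>0: "r\<^sub>0 < t"
      "\<And>s. r\<^sub>0 < s \<Longrightarrow> s < t \<Longrightarrow> X s \<in> I - E \<and> t\<^sub>0 < s \<and> damping \<omega> (X s) s \<ge> - (1 - ?l)"
      unfolding eventually_at_left_field by blast
    \<comment> \<open>Gronwall is applied on an interval containing its left end, whereas the bounds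
      hold on an open one; a midpoint lies safely inside.\<close>
    define r where "r = (r\<^sub>0 + t) / 2"
    have r: "r\<^sub>0 < r" "r < t" using r\<^sub>0 by (auto simp: r_def)
    have in_s: "X s \<in> I - E" "s \<in> interior J" "t\<^sub>0 < s" "damping \<omega> (X s) s \<ge> - (1 - ?l)" if "r \<le> s" "s < t" for s
    proof -
      show "X s \<in> I - E" and s: "t\<^sub>0 < s" and "damping \<omega> (X s) s \<ge> - (1 - ?l)"
        using r\<^sub>0(2)[of s] r that by auto
      have "{t\<^sub>0<..<t\<^sub>1} \<subseteq> interior J" using J by (intro interior_maximal) auto
      then show "s \<in> interior J" using s that t by auto
    qed
    have "\<sigma> * W\<^sub>\<delta> \<omega> (- \<omega>) (X t) t > 0"
    proof (rule gronwall_positive_limit[OF r(2)])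
      fix s assume s: "r \<le> s" "s < t"
      note in_s = in_s[OF s]
      have "X s \<in> I" "s \<in> J" using in_s interior_subset by auto
      \<comment> \<open>Off the exceptional set both traces of the sound speed agree, so the two
        one-sided derivatives merge.\<close>
      have "(X has_real_derivative \<omega> * c (X s) s) (at s)"
        using left[of s] right[of s] in_s s t \<omega> \<omega>'
        by (intro has_real_derivative_split) (auto simp: c\<delta>_eq)
      from DERIV_cmult[OF W_along_characteristic[OF in_s(1,2) \<omega> this], of \<sigma>]
      show "((\<lambda>s. \<sigma> * W \<omega> (X s) s) has_real_derivative damping \<omega> (X s) s * (\<sigma> * W \<omega> (X s) s)
          + c (X s) s * k / 2 * (\<sigma> * (\<omega> * S' (X s) * W (- \<omega>) (X s) s))) (at s)"
        by (simp add: algebra_simps)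
      show "\<sigma> * W \<omega> (X s) s > 0"
        using before[of s] in_s s \<omega> by (auto simp: W\<delta>_eq)
      have "s \<in> {t\<^sub>0..t\<^sub>1}" "X s \<notin> E" using in_s s t by auto
      from c_pos[OF \<open>X s \<in> I\<close> \<open>s \<in> J\<close>] pos
      show "c (X s) s * k / 2 * (\<sigma> * (\<omega> * S' (X s) * W (- \<omega>) (X s) s)) \<ge> 0"
        by (intro mult_nonneg_nonneg[OF _ source[OF \<open>s \<in> {t\<^sub>0..t\<^sub>1}\<close> \<open>X s \<notin> E\<close>]]) auto
      show "damping \<omega> (X s) s \<ge> - (1 - ?l)" by (rule in_s)
    next
      show "((\<lambda>s. \<sigma> * W \<omega> (X s) s) \<longlongrightarrow> \<sigma> * W\<^sub>\<delta> \<omega> (- \<omega>) (X t) t) (at_left t)"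
        by (intro tendsto_mult tendsto_const tendsto_W[OF hyps])
    qed
    then show "\<sigma> * W\<^sub>\<delta> \<omega> \<omega> (X t) t > 0"
      using W\<delta>_sign[OF x \<omega>' \<omega>] by blast
  qed
qed

text \<open>The contrapositive of persistence: if the opposite wave never has the sign -(\<sigma>
  \<omega> \<rho>), the source never opposes the sign \<sigma> of W. All characters are expressed by
  the trace on the side 1, and \<open>W\<delta>_sign\<close> translates from and to the side
  \<omega>.\<close>

lemma W_changes_sign:
  assumes J: "{t\<^sub>0..t\<^sub>1} \<subseteq> J" and XI: "X ` {t\<^sub>0..t\<^sub>1} \<subseteq> I"
    and signs: "\<omega> \<in> {1, -1}" "\<sigma> \<in> {1, -1}" "\<rho> \<in> {1, -1}"
    and right: "\<And>t. t \<in> {t\<^sub>0..<t\<^sub>1} \<Longrightarrow> (X has_real_derivative \<omega> * c\<^sub>\<delta> \<omega> (X t) t) (at_right t)"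
    and left: "\<And>t. t \<in> {t\<^sub>0<..t\<^sub>1} \<Longrightarrow> (X has_real_derivative \<omega> * c\<^sub>\<delta> (- \<omega>) (X t) t) (at_left t)"
    and S': "\<And>x. x \<in> I - E \<Longrightarrow> \<rho> * S' x \<ge> 0"
    and start: "\<sigma> * W\<^sub>\<delta> \<omega> 1 (X t\<^sub>0) t\<^sub>0 > 0"
    and t: "t \<in> {t\<^sub>0..t\<^sub>1}" "\<not> \<sigma> * W\<^sub>\<delta> \<omega> 1 (X t) t > 0"
  shows "\<exists>t\<in>{t\<^sub>0..t\<^sub>1}. - (\<sigma> * \<omega> * \<rho>) * W\<^sub>\<delta> (- \<omega>) 1 (X t) t > 0"
proof (rule ccontr)
  assume contra: "\<not> ?thesis"
  have in_IJ: "X s \<in> I" "s \<in> J" if "s \<in> {t\<^sub>0..t\<^sub>1}" for s using that J XI by auto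
  have one: "1 \<in> {1, -1 :: real}" by simp
  have "\<sigma> * W\<^sub>\<delta> \<omega> \<omega> (X t) t > 0"
  proof (rule W_sign_persists[OF J XI signs(1) right left])
    fix s assume s: "s \<in> {t\<^sub>0..t\<^sub>1}" "X s \<notin> E"
    then have "- (\<sigma> * \<omega> * \<rho>) * W (- \<omega>) (X s) s \<le> 0"
      using contra in_IJ(1)[OF s(1)] W\<delta>_eq[OF _ one, of "X s"] by (metis DiffI not_less)
    \<comment> \<open>Two nonnegative factors, one from the monotone entropy and one from the
      opposite wave; their product is the source because \<rho>^2 = 1.\<close>
    then have "(\<rho> * S' (X s)) * (\<sigma> * \<omega> * \<rho> * W (- \<omega>) (X s) s) \<ge> 0"
      using S'[of "X s"] in_IJ[OF s(1)] s(2) by (intro mult_nonneg_nonneg[of "\<rho> * S' (X s)"]) auto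
    also have "(\<rho> * S' (X s)) * (\<sigma> * \<omega> * \<rho> * W (- \<omega>) (X s) s) = \<sigma> * (\<omega> * S' (X s) * W (- \<omega>) (X s) s)"
      using signs(3) by auto
    finally show "0 \<le> \<sigma> * (\<omega> * S' (X s) * W (- \<omega>) (X s) s)" .
  next
    show "\<sigma> * W\<^sub>\<delta> \<omega> \<omega> (X t\<^sub>0) t\<^sub>0 > 0"
      by (rule W\<delta>_sign[OF in_IJ one signs(1) start]) (use t in auto)
  qed (use t in auto)
  then show False
    using W\<delta>_sign[OF in_IJ[OF t(1)] signs(1) one] t(2) by blast
qed

text \<open>
  \<open>f\<close> is \<^const>\<open>alpha\<close> for \<open>\<omega> = 1\<close> and \<^const>\<open>beta\<close> for \<open>\<omega> = -1\<close>.
\<close>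

lemma
  assumes f: "\<And>y. y \<in> I - E \<Longrightarrow> f y t = W \<omega> y t / (c y t)\<^sup>2" and x: "x \<in> I" "t \<in> J"
  shows pos_at_iff: "pos_at f x t \<longleftrightarrow> 1 * W\<^sub>\<delta> \<omega> 1 x t > 0"
    and neg_at_iff: "neg_at f x t \<longleftrightarrow> - 1 * W\<^sub>\<delta> \<omega> 1 x t > 0"
proof -
  have lim: "Lim (side \<delta> x) (\<lambda>y. f y t) = W\<^sub>\<delta> \<omega> \<delta> x t / (c\<^sub>\<delta> \<delta> x t)\<^sup>2" if \<delta>: "\<delta> \<in> {1, -1}" for \<delta>
  proof (rule tendsto_Lim[OF side_neq_bot[OF \<delta>]])
    have X: "filterlim (\<lambda>y. y) (side \<delta> x) (side \<delta> x)" by (rule filterlim_ident)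
    have T: "((\<lambda>y. t) \<longlongrightarrow> t) (side \<delta> x)" "\<forall>\<^sub>F y in side \<delta> x. t \<in> J" using x by auto
    note hyps = x \<delta> X T
    have "((\<lambda>y. W \<omega> y t / (c y t)\<^sup>2) \<longlongrightarrow> W\<^sub>\<delta> \<omega> \<delta> x t / (c\<^sub>\<delta> \<delta> x t)\<^sup>2) (side \<delta> x)"
      using c\<delta>_pos[OF x, of \<delta>] by (intro tendsto_intros tendsto_W[OF hyps] tendsto_c[OF hyps]) auto
    moreover have "\<forall>\<^sub>F y in side \<delta> x. W \<omega> y t / (c y t)\<^sup>2 = f y t"
      using eventually_I[OF hyps] by eventually_elim (simp add: f)
    ultimately show "((\<lambda>y. f y t) \<longlongrightarrow> W\<^sub>\<delta> \<omega> \<delta> x t / (c\<^sub>\<delta> \<delta> x t)\<^sup>2) (side \<delta> x)"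
      by (rule Lim_transform_eventually)
  qed
  have "c\<^sub>\<delta> 1 x t > 0" "c\<^sub>\<delta> (-1) x t > 0" using c\<delta>_pos x by auto
  \<comment> \<open>Both one-sided limits have the same sign, so the condition on two sides reduces
    to the trace on the side 1.\<close>
  then show "pos_at f x t \<longleftrightarrow> 1 * W\<^sub>\<delta> \<omega> 1 x t > 0" "neg_at f x t \<longleftrightarrow> - 1 * W\<^sub>\<delta> \<omega> 1 x t > 0"
    using lim[of 1] lim[of "-1"] W\<delta>_sign[OF x, of 1 "-1" 1 \<omega>] W\<delta>_sign[OF x, of 1 "-1" "-1" \<omega>]
    by (auto simp: pos_at_def neg_at_def zero_less_divide_iff divide_less_0_iff)
qed

lemma Lim_c:
  assumes "x \<in> I" "t \<in> J" "\<delta> \<in> {1, -1}" and f: "\<And>y. y \<in> I - E \<Longrightarrow> f y = c y t"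
  shows "Lim (side \<delta> x) f = c\<^sub>\<delta> \<delta> x t"
proof (rule tendsto_Lim[OF side_neq_bot[OF assms(3)]])
  have X: "filterlim (\<lambda>y. y) (side \<delta> x) (side \<delta> x)" by (rule filterlim_ident)
  have T: "((\<lambda>y. t) \<longlongrightarrow> t) (side \<delta> x)" "\<forall>\<^sub>F y in side \<delta> x. t \<in> J" using assms by auto
  have "\<forall>\<^sub>F y in side \<delta> x. c y t = f y"
    using eventually_I[OF assms(1-3) X T] by eventually_elim (simp add: f)
  with tendsto_c[OF assms(1-3) X T] show "(f \<longlongrightarrow> c\<^sub>\<delta> \<delta> x t) (side \<delta> x)"
    by (rule Lim_transform_eventually)
qed

end

section \<open>Polytropic gas\<close>

lemma specific_volume_eq:
  assumes "\<gamma> > 1" "K > 0" "v > 0"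
  shows "v = (pressure_law \<gamma> K c\<^sub>v s v / (K * exp (s / c\<^sub>v))) powr (- 1 / \<gamma>)"
  using assms by (simp add: pressure_law_def powr_powr)

text \<open>Eliminates the volume, which jumps with the entropy, in favour of the continuous
  pressure. The exponent comes from (v^(-\<gamma>))^(1 + 1/\<gamma>) = v^(-\<gamma> - 1), halved by
  the square root; the other factors correct the powers of K and of exp (s /
  \<open>c\<^sub>v\<close>).\<close>

lemma sound_speed_pressure:
  assumes "\<gamma> > 1" "K > 0" "v > 0"
  shows "sound_speed \<gamma> K c\<^sub>v s v = sqrt (\<gamma> * K powr (- 1 / \<gamma>)) * exp (- (1 / (2 * \<gamma> * c\<^sub>v)) * s)
    * pressure_law \<gamma> K c\<^sub>v s v powr ((\<gamma> + 1) / (2 * \<gamma>))"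
proof -
  let ?\<kappa> = "(\<gamma> + 1) / (2 * \<gamma>)"
  have "?\<kappa> + ?\<kappa> = 1 + 1 / \<gamma>" using assms by (simp add: add_divide_distrib)
  then have "(pressure_law \<gamma> K c\<^sub>v s v powr ?\<kappa>)\<^sup>2 = pressure_law \<gamma> K c\<^sub>v s v powr (1 + 1 / \<gamma>)"
    by (simp add: power2_eq_square flip: powr_add)
  also have "\<dots> = K powr (1 + 1 / \<gamma>) * exp (s / c\<^sub>v * (1 + 1 / \<gamma>)) * v powr (- \<gamma> * (1 + 1 / \<gamma>))"
    using assms by (simp add: pressure_law_def powr_mult powr_powr exp_powr_real)
  also have "- \<gamma> * (1 + 1 / \<gamma>) = - \<gamma> - 1" using assms by (simp add: field_simps)
  also have "K powr (1 + 1 / \<gamma>) = K * K powr (1 / \<gamma>)" using assms by (simp add: powr_add)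
  finally have 1: "(pressure_law \<gamma> K c\<^sub>v s v powr ?\<kappa>)\<^sup>2
      = K * K powr (1 / \<gamma>) * exp (s / c\<^sub>v * (1 + 1 / \<gamma>)) * v powr (- \<gamma> - 1)" .
  have 2: "(exp (- (1 / (2 * \<gamma> * c\<^sub>v)) * s))\<^sup>2 = exp (- (s / (c\<^sub>v * \<gamma>)))"
    by (simp add: power2_eq_square flip: exp_add)
  have 3: "K powr (- 1 / \<gamma>) * K powr (1 / \<gamma>) = 1" using assms by (simp flip: powr_add)
  have 4: "exp (- (s / (c\<^sub>v * \<gamma>))) * exp (s / c\<^sub>v * (1 + 1 / \<gamma>)) = exp (s / c\<^sub>v)"
    by (simp add: algebra_simps flip: exp_add)
  have "(sqrt (\<gamma> * K powr (- 1 / \<gamma>)) * exp (- (1 / (2 * \<gamma> * c\<^sub>v)) * s)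
      * pressure_law \<gamma> K c\<^sub>v s v powr ?\<kappa>)\<^sup>2
    = \<gamma> * K powr (- 1 / \<gamma>) * exp (- (s / (c\<^sub>v * \<gamma>)))
      * (K * K powr (1 / \<gamma>) * exp (s / c\<^sub>v * (1 + 1 / \<gamma>)) * v powr (- \<gamma> - 1))"
    using assms unfolding power_mult_distrib 1 2 by simp
  also have "\<dots> = (K powr (- 1 / \<gamma>) * K powr (1 / \<gamma>)) * (exp (- (s / (c\<^sub>v * \<gamma>))) * exp (s / c\<^sub>v * (1 + 1 / \<gamma>)))
      * (K * \<gamma> * v powr (- \<gamma> - 1))"
    by (simp only: mult_ac)
  also have "\<dots> = K * \<gamma> * exp (s / c\<^sub>v) * v powr (- \<gamma> - 1)" unfolding 3 4 by simp
  finally show ?thesis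
    unfolding sound_speed_explicit[OF assms(3)] using assms by (intro real_sqrt_unique) auto
qed

text \<open>\<open>dt\<close> is a total operator, so the mass equation does not itself provide a
  derivative of \<tau>. Its existence is obtained by inverting the pressure law, which writes \<tau>
  as a power of the differentiable p; then the pressure law is differentiated at fixed
  entropy.\<close>

lemma pressure_time_derivative:
  assumes "\<gamma> > 1" "K > 0" and J: "is_interval J" "interior J \<noteq> {}" "t \<in> J"
    and state: "\<And>s. s \<in> J \<Longrightarrow> \<tau> x s > 0 \<and> p x s = pressure_law \<gamma> K c\<^sub>v e (\<tau> x s)"
    and p: "((\<lambda>s. p x s) has_real_derivative D) (at t within J)"
  shows "D = - (sound_speed \<gamma> K c\<^sub>v e (\<tau> x t))\<^sup>2 * dt J \<tau> x t"
proof -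
  define A where "A = K * exp (e / c\<^sub>v)"
  have A: "A > 0" using assms by (simp add: A_def)
  have \<tau>: "\<tau> x s = (p x s / A) powr (- 1 / \<gamma>)" if "s \<in> J" for s
    using specific_volume_eq[OF assms(1,2), of "\<tau> x s" c\<^sub>v e] state[OF that] by (simp add: A_def)
  have "p x t / A > 0" using state[OF J(3)] A \<open>K > 0\<close> by (auto simp: pressure_law_def intro!: divide_pos_pos mult_pos_pos)
  then have "\<exists>D'. ((\<lambda>s. (p x s / A) powr (- 1 / \<gamma>)) has_real_derivative D') (at t within J)"
    using DERIV_chain2[OF has_real_derivative_powr DERIV_cdivide[OF p, of A]] by blast
  then obtain D' where "((\<lambda>s. (p x s / A) powr (- 1 / \<gamma>)) has_real_derivative D') (at t within J)" ..
  then have D': "((\<lambda>s. \<tau> x s) has_real_derivative D') (at t within J)"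
    by (rule has_field_derivative_transform_within[OF _ zero_less_one J(3)]) (use \<tau> in auto)
  then have dt: "dt J \<tau> x t = D'" by (rule dt_eq[OF J])
  have v: "\<tau> x t > 0" using state J by blast
  have "((\<lambda>s. A * \<tau> x s powr (- \<gamma>)) has_real_derivative A * (- \<gamma> * \<tau> x t powr (- \<gamma> - 1) * D')) (at t within J)"
    using v by (auto intro!: derivative_eq_intros D' simp: powr_diff field_simps)
  then have "((\<lambda>s. p x s) has_real_derivative A * (- \<gamma> * \<tau> x t powr (- \<gamma> - 1) * D')) (at t within J)"
    by (rule has_field_derivative_transform_within[OF _ zero_less_one J(3)])
      (use state in \<open>auto simp: pressure_law_def A_def\<close>)
  then have "D = A * (- \<gamma> * \<tau> x t powr (- \<gamma> - 1) * D')"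
    using p at_within_nondegenerate_interval_neq_bot[OF J] has_field_derivative_unique by blast
  then show ?thesis
    using assms(1,2) v by (simp add: dt sound_speed_explicit A_def)
qed

text \<open>The chain rule gives m' = m S' / (2 \<open>c\<^sub>v\<close>) with m > 0, so m' and S'
  have the same sign.\<close>

lemma mono_m_var_imp_deriv_nonneg:
  assumes "\<gamma> > 1" "K > 0" "c\<^sub>v > 0" and A: "open A" "x \<in> A" and S: "(S has_real_derivative D) (at x)"
  shows "mono_on A (\<lambda>x. m_var \<gamma> K c\<^sub>v (S x)) \<Longrightarrow> D \<ge> 0"
    and "antimono_on A (\<lambda>x. m_var \<gamma> K c\<^sub>v (S x)) \<Longrightarrow> D \<le> 0"
proof -
  define M where "M = (\<lambda>x. m_var \<gamma> K c\<^sub>v (S x))"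
  have "Cm_const \<gamma> K > 0"
    using Cz_pos[OF assms(1)] assms by (simp add: Cm_const_def)
  then obtain q where q: "q = M x / (2 * c\<^sub>v)" and f: "q > 0"
    using assms by (simp add: M_def m_var_def)
  have der: "(M has_real_derivative q * D) (at x)"
    unfolding q M_def m_var_def using \<open>c\<^sub>v > 0\<close> by (auto intro!: derivative_eq_intros S)
  have int: "x \<in> interior A" using A by (simp add: interior_open)
  show "D \<ge> 0" if "mono_on A (\<lambda>x. m_var \<gamma> K c\<^sub>v (S x))"
    using mono_on_imp_deriv_nonneg[OF that[folded M_def] der int] f by (simp add: zero_le_mult_iff)
  show "D \<le> 0" if anti: "antimono_on A (\<lambda>x. m_var \<gamma> K c\<^sub>v (S x))"
  proof -
    have "mono_on A (\<lambda>x. - M x)"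
      using anti unfolding M_def[symmetric] by (auto simp: monotone_on_def)
    from mono_on_imp_deriv_nonneg[OF this DERIV_minus[OF der] int] f show ?thesis
      by (simp add: mult_le_0_iff)
  qed
qed

section \<open>Reduction of the Euler equations to the acoustic setting\<close>

theorem theorem1:
  fixes \<gamma> K c\<^sub>v :: real and I J E :: "real set"
    and \<tau> u p :: "real \<Rightarrow> real \<Rightarrow> real" and S m :: "real \<Rightarrow> real" and c :: "real \<Rightarrow> real \<Rightarrow> real"
  assumes "\<gamma> > 1" "K > 0" "c\<^sub>v > 0"
    and "shock_free_solution \<gamma> K c\<^sub>v I J E \<tau> u p S"
  defines "m \<equiv> \<lambda>x. m_var \<gamma> K c\<^sub>v (S x)"
    and "c \<equiv> c_field \<gamma> K c\<^sub>v \<tau> S"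
  shows
    "(mono_on (I - E) m \<longrightarrow>
       (\<forall>X t\<^sub>0 t\<^sub>1. forward_characteristic I J c X t\<^sub>0 t\<^sub>1 \<longrightarrow>
          (changes_character (forward_R J c p) X t\<^sub>0 t\<^sub>1 \<longrightarrow> crosses (backward_C J c p) X t\<^sub>0 t\<^sub>1) \<and>
          (changes_character (forward_C J c p) X t\<^sub>0 t\<^sub>1 \<longrightarrow> crosses (backward_R J c p) X t\<^sub>0 t\<^sub>1)) \<and>
       (\<forall>X t\<^sub>0 t\<^sub>1. backward_characteristic I J c X t\<^sub>0 t\<^sub>1 \<longrightarrow>
          (changes_character (backward_C J c p) X t\<^sub>0 t\<^sub>1 \<longrightarrow> crosses (forward_C J c p) X t\<^sub>0 t\<^sub>1) \<and>
          (changes_character (backward_R J c p) X t\<^sub>0 t\<^sub>1 \<longrightarrow> crosses (forward_R J c p) X t\<^sub>0 t\<^sub>1)))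
   \<and> (antimono_on (I - E) m \<longrightarrow>
       (\<forall>X t\<^sub>0 t\<^sub>1. forward_characteristic I J c X t\<^sub>0 t\<^sub>1 \<longrightarrow>
          (changes_character (forward_R J c p) X t\<^sub>0 t\<^sub>1 \<longrightarrow> crosses (backward_R J c p) X t\<^sub>0 t\<^sub>1) \<and>
          (changes_character (forward_C J c p) X t\<^sub>0 t\<^sub>1 \<longrightarrow> crosses (backward_C J c p) X t\<^sub>0 t\<^sub>1)) \<and>
       (\<forall>X t\<^sub>0 t\<^sub>1. backward_characteristic I J c X t\<^sub>0 t\<^sub>1 \<longrightarrow>
          (changes_character (backward_C J c p) X t\<^sub>0 t\<^sub>1 \<longrightarrow> crosses (forward_R J c p) X t\<^sub>0 t\<^sub>1) \<and>
          (changes_character (backward_R J c p) X t\<^sub>0 t\<^sub>1 \<longrightarrow> crosses (forward_C J c p) X t\<^sub>0 t\<^sub>1)))"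
proof -
  have I: "open I" and J: "is_interval J" "interior J \<noteq> {}" and u2: "C2_on I J u" and p2: "C2_on I J p"
    and p_pos: "\<And>x t. x \<in> I \<Longrightarrow> t \<in> J \<Longrightarrow> p x t > 0" and S2: "piecewise_C2_entropy I E S"
    and euler: "euler_equations \<gamma> K c\<^sub>v (I - E) J \<tau> u p S"
    using assms(4) by (auto simp: shock_free_solution_def)
  obtain p\<^sub>x p\<^sub>t p\<^sub>x\<^sub>x p\<^sub>x\<^sub>t p\<^sub>t\<^sub>x p\<^sub>t\<^sub>t where p: "has_partials_on I J p p\<^sub>x p\<^sub>t" "has_partials_on I J p\<^sub>x p\<^sub>x\<^sub>x p\<^sub>x\<^sub>t"
      "has_partials_on I J p\<^sub>t p\<^sub>t\<^sub>x p\<^sub>t\<^sub>t"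
    and p_cont: "\<forall>g\<in>{p, p\<^sub>x, p\<^sub>t, p\<^sub>x\<^sub>x, p\<^sub>x\<^sub>t, p\<^sub>t\<^sub>x, p\<^sub>t\<^sub>t}. continuous_on (I \<times> J) (\<lambda>(x, t). g x t)"
    using p2 unfolding C2_on_def by blast
  obtain u\<^sub>x u\<^sub>t u\<^sub>x\<^sub>x u\<^sub>x\<^sub>t u\<^sub>t\<^sub>x u\<^sub>t\<^sub>t where u: "has_partials_on I J u u\<^sub>x u\<^sub>t" "has_partials_on I J u\<^sub>x u\<^sub>x\<^sub>x u\<^sub>x\<^sub>t"
      "has_partials_on I J u\<^sub>t u\<^sub>t\<^sub>x u\<^sub>t\<^sub>t"
    and u_cont: "\<forall>g\<in>{u, u\<^sub>x, u\<^sub>t, u\<^sub>x\<^sub>x, u\<^sub>x\<^sub>t, u\<^sub>t\<^sub>x, u\<^sub>t\<^sub>t}. continuous_on (I \<times> J) (\<lambda>(x, t). g x t)"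
    using u2 unfolding C2_on_def by blast
  have dx: "dx p x t = p\<^sub>x x t" "dx u x t = u\<^sub>x x t" and dt: "dt J p x t = p\<^sub>t x t" "dt J u x t = u\<^sub>t x t"
    if "x \<in> I" "t \<in> J" for x t
    using has_partials_onD[OF p(1) that] has_partials_onD[OF u(1) that] dx_eq dt_eq[OF J that(2)]
    by blast+
  have finite_E: "finite E" using S2 by (simp add: piecewise_C2_entropy_def)
  \<comment> \<open>The derivative provided by the regularity of the entropy is identified with
    \<open>deriv S\<close>, the function whose one-sided limits are known to exist.\<close>
  have S: "(S has_real_derivative deriv S x) (at x)" if "x \<in> I - E" for x
    using S2 that unfolding piecewise_C2_entropy_def by (metis DERIV_imp_deriv)
  \<comment> \<open>\<open>Lim\<close> yields a meaningful value only where a limit exists; here it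
    becomes the actual trace.\<close>
  have S_lims: "(S \<longlongrightarrow> Lim (side \<delta> x) S) (side \<delta> x)" "(deriv S \<longlongrightarrow> Lim (side \<delta> x) (deriv S)) (side \<delta> x)"
    if \<delta>: "\<delta> \<in> {1, -1}" and "x \<in> I" for \<delta> x
  proof -
    have "side \<delta> x \<in> {at_left x, at_right x}" using \<delta> by auto
    then obtain l l' where "(S \<longlongrightarrow> l) (side \<delta> x)" "(deriv S \<longlongrightarrow> l') (side \<delta> x)"
      using S2 \<open>x \<in> I\<close> unfolding piecewise_C2_entropy_def by blast
    then show "(S \<longlongrightarrow> Lim (side \<delta> x) S) (side \<delta> x)" "(deriv S \<longlongrightarrow> Lim (side \<delta> x) (deriv S)) (side \<delta> x)"
      using tendsto_Lim[OF side_neq_bot[OF \<delta>]] by metis+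
  qed
  \<comment> \<open>The constants that \<open>sound_speed_pressure\<close> produces when c is
    written in terms of S and p.\<close>
  define c\<^sub>0 k \<kappa> where "c\<^sub>0 = sqrt (\<gamma> * K powr (- 1 / \<gamma>))" and "k = 1 / (2 * \<gamma> * c\<^sub>v)"
    and "\<kappa> = (\<gamma> + 1) / (2 * \<gamma>)"
  have state: "\<tau> x t > 0 \<and> p x t = pressure_law \<gamma> K c\<^sub>v (S x) (\<tau> x t)"
    and eqs: "dt J \<tau> x t = u\<^sub>x x t" "u\<^sub>t x t = - p\<^sub>x x t" if "x \<in> I - E" "t \<in> J" for x t
  proof -
    have "x \<in> I" using that by simp
    note [simp] = dx[OF this that(2)] dt[OF this that(2)]
    show "\<tau> x t > 0 \<and> p x t = pressure_law \<gamma> K c\<^sub>v (S x) (\<tau> x t)" "dt J \<tau> x t = u\<^sub>x x t"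
      using euler that unfolding euler_equations_def by force+
    have "dt J u x t + dx p x t = 0" using euler that unfolding euler_equations_def by blast
    then show "u\<^sub>t x t = - p\<^sub>x x t" by simp
  qed
  have c_eq: "c x t = c\<^sub>0 * exp (- k * S x) * p x t powr \<kappa>" if "x \<in> I - E" "t \<in> J" for x t
    using sound_speed_pressure[OF assms(1,2), of "\<tau> x t" c\<^sub>v "S x"] state[OF that]
    by (simp add: c_def c_field_def c\<^sub>0_def k_def \<kappa>_def)
  have p\<^sub>t: "p\<^sub>t x t = - (c\<^sub>0 * exp (- k * S x) * p x t powr \<kappa>)\<^sup>2 * u\<^sub>x x t" if "x \<in> I - E" "t \<in> J" for x t
  proof -
    have "x \<in> I" using that by simp
    have "p\<^sub>t x t = - (c x t)\<^sup>2 * dt J \<tau> x t"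
      unfolding c_def c_field_def
      by (rule pressure_time_derivative[where \<tau> = \<tau> and p = p and x = x,
            OF assms(1,2) J that(2) state[OF that(1)] has_partials_onD(2)[OF p(1) \<open>x \<in> I\<close> that(2)]])
    then show ?thesis unfolding eqs(1)[OF that] c_eq[OF that] .
  qed
  interpret A: acoustic_field I J E p p\<^sub>x p\<^sub>t p\<^sub>x\<^sub>x p\<^sub>x\<^sub>t p\<^sub>t\<^sub>x p\<^sub>t\<^sub>t u u\<^sub>x u\<^sub>t u\<^sub>x\<^sub>x u\<^sub>x\<^sub>t u\<^sub>t\<^sub>x u\<^sub>t\<^sub>t S "deriv S"
    "\<lambda>\<delta> x. Lim (side \<delta> x) S" "\<lambda>\<delta> x. Lim (side \<delta> x) (deriv S)" c\<^sub>0 k \<kappa>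
  proof
    show "c\<^sub>0 > 0" "k > 0" using assms by (auto simp: c\<^sub>0_def k_def)
    show "continuous_on (I \<times> J) (\<lambda>(x, t). g x t)"
      if "g \<in> {p, p\<^sub>x, p\<^sub>t, p\<^sub>x\<^sub>t, p\<^sub>t\<^sub>x, p\<^sub>t\<^sub>t, u\<^sub>x, u\<^sub>x\<^sub>t, u\<^sub>t\<^sub>x}" for g
      using that p_cont u_cont by blast
  qed (use I finite_E p u p_pos S S_lims p\<^sub>t eqs in auto)
  have c: "c x t = A.c x t" if "x \<in> I - E" "t \<in> J" for x t
    using c_eq that by (simp add: A.c_def)
  have W: "alpha J c p x t = A.W 1 x t / (A.c x t)\<^sup>2" "beta J c p x t = A.W (-1) x t / (A.c x t)\<^sup>2"
    if "x \<in> I - E" "t \<in> J" for x t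
    using that dx dt by (simp_all add: alpha_def beta_def A.W_def c)
  have char: "forward_R J c p x t \<longleftrightarrow> 1 * A.W\<^sub>\<delta> 1 1 x t > 0"
      "forward_C J c p x t \<longleftrightarrow> - 1 * A.W\<^sub>\<delta> 1 1 x t > 0"
      "backward_R J c p x t \<longleftrightarrow> 1 * A.W\<^sub>\<delta> (-1) 1 x t > 0"
      "backward_C J c p x t \<longleftrightarrow> - 1 * A.W\<^sub>\<delta> (-1) 1 x t > 0"
    if "x \<in> I" "t \<in> J" for x t
    unfolding forward_R_def forward_C_def backward_R_def backward_C_def
    by (rule A.pos_at_iff[OF _ that] A.neg_at_iff[OF _ that], erule W[OF _ that(2)])+
  have Lim_c: "Lim (side \<delta> x) (\<lambda>y. c y t) = A.c\<^sub>\<delta> \<delta> x t" if "x \<in> I" "t \<in> J" "\<delta> \<in> {1, -1}" for \<delta> x t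
    by (rule A.Lim_c[OF that]) (rule c[OF _ that(2)])
  \<comment> \<open>Covers all eight claims: \<omega> is the direction of the wave followed,
    \<sigma> is 1 for R and -1 for C, \<rho> is 1 for nondecreasing and -1 for nonincreasing
    entropy. The wave to be crossed has direction -\<omega> and sign -(\<sigma> \<omega>
    \<rho>).\<close>
  have changes: "crosses Q X t\<^sub>0 t\<^sub>1"
    if IJ: "{t\<^sub>0..t\<^sub>1} \<subseteq> J" "X ` {t\<^sub>0..t\<^sub>1} \<subseteq> I"
      and signs: "\<omega> \<in> {1, -1}" "\<sigma> \<in> {1, -1}" "\<rho> \<in> {1, -1}"
      and right: "\<forall>t\<in>{t\<^sub>0..<t\<^sub>1}. (X has_real_derivative \<omega> * Lim (side \<omega> (X t)) (\<lambda>y. c y t)) (at_right t)"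
      and left: "\<forall>t\<in>{t\<^sub>0<..t\<^sub>1}. (X has_real_derivative \<omega> * Lim (side (- \<omega>) (X t)) (\<lambda>y. c y t)) (at_left t)"
      and S': "\<And>x. x \<in> I - E \<Longrightarrow> \<rho> * deriv S x \<ge> 0"
      and P: "\<And>x t. x \<in> I \<Longrightarrow> t \<in> J \<Longrightarrow> P x t \<longleftrightarrow> \<sigma> * A.W\<^sub>\<delta> \<omega> 1 x t > 0"
      and Q: "\<And>x t. x \<in> I \<Longrightarrow> t \<in> J \<Longrightarrow> Q x t \<longleftrightarrow> - (\<sigma> * \<omega> * \<rho>) * A.W\<^sub>\<delta> (- \<omega>) 1 x t > 0"
      and change: "changes_character P X t\<^sub>0 t\<^sub>1"
    for P Q X t\<^sub>0 t\<^sub>1 \<omega> \<sigma> \<rho>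
  proof -
    obtain t where t: "t \<in> {t\<^sub>0..t\<^sub>1}" "\<not> P (X t) t" and start: "P (X t\<^sub>0) t\<^sub>0"
      using change by (auto simp: changes_character_def)
    have in_IJ: "X s \<in> I" "s \<in> J" if "s \<in> {t\<^sub>0..t\<^sub>1}" for s using that IJ by auto
    have "t\<^sub>0 \<in> {t\<^sub>0..t\<^sub>1}" using t by auto
    have "- \<omega> \<in> {1, -1}" using signs by auto
    have "\<exists>t\<in>{t\<^sub>0..t\<^sub>1}. - (\<sigma> * \<omega> * \<rho>) * A.W\<^sub>\<delta> (- \<omega>) 1 (X t) t > 0"
    proof (rule A.W_changes_sign[OF IJ signs _ _ S' _ t(1)])
      show "(X has_real_derivative \<omega> * A.c\<^sub>\<delta> \<omega> (X s) s) (at_right s)" if "s \<in> {t\<^sub>0..<t\<^sub>1}" for s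
        using bspec[OF right that] that Lim_c[OF in_IJ(1,2)[of s] signs(1)] by auto
      show "(X has_real_derivative \<omega> * A.c\<^sub>\<delta> (- \<omega>) (X s) s) (at_left s)" if "s \<in> {t\<^sub>0<..t\<^sub>1}" for s
        using bspec[OF left that] that Lim_c[OF in_IJ(1,2)[of s] \<open>- \<omega> \<in> {1, -1}\<close>] by auto
      show "\<sigma> * A.W\<^sub>\<delta> \<omega> 1 (X t\<^sub>0) t\<^sub>0 > 0" using start P in_IJ[OF \<open>t\<^sub>0 \<in> {t\<^sub>0..t\<^sub>1}\<close>] by blast
      show "\<not> \<sigma> * A.W\<^sub>\<delta> \<omega> 1 (X t) t > 0" using t P in_IJ by blast
    qed
    then show ?thesis using Q in_IJ unfolding crosses_def by blast
  qed
  have "open (I - E)" using I finite_E by (intro open_Diff finite_imp_closed)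
  note S'_sign = mono_m_var_imp_deriv_nonneg[OF assms(1-3) this _ S, folded m_def]
  have forward: "crosses Q X t\<^sub>0 t\<^sub>1"
    if "forward_characteristic I J c X t\<^sub>0 t\<^sub>1" "\<sigma> \<in> {1, -1}" "\<rho> \<in> {1, -1}"
      "\<And>x. x \<in> I - E \<Longrightarrow> \<rho> * deriv S x \<ge> 0" "changes_character P X t\<^sub>0 t\<^sub>1"
      "\<And>x t. x \<in> I \<Longrightarrow> t \<in> J \<Longrightarrow> P x t \<longleftrightarrow> \<sigma> * A.W\<^sub>\<delta> 1 1 x t > 0"
      "\<And>x t. x \<in> I \<Longrightarrow> t \<in> J \<Longrightarrow> Q x t \<longleftrightarrow> - (\<sigma> * \<rho>) * A.W\<^sub>\<delta> (-1) 1 x t > 0" for P Q X t\<^sub>0 t\<^sub>1 \<sigma> \<rho>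
    by (rule changes[of t\<^sub>0 t\<^sub>1 X 1 \<sigma> \<rho> P]) (use that in \<open>auto simp: forward_characteristic_def\<close>)
  have backward: "crosses Q X t\<^sub>0 t\<^sub>1"
    if "backward_characteristic I J c X t\<^sub>0 t\<^sub>1" "\<sigma> \<in> {1, -1}" "\<rho> \<in> {1, -1}"
      "\<And>x. x \<in> I - E \<Longrightarrow> \<rho> * deriv S x \<ge> 0" "changes_character P X t\<^sub>0 t\<^sub>1"
      "\<And>x t. x \<in> I \<Longrightarrow> t \<in> J \<Longrightarrow> P x t \<longleftrightarrow> \<sigma> * A.W\<^sub>\<delta> (-1) 1 x t > 0"
      "\<And>x t. x \<in> I \<Longrightarrow> t \<in> J \<Longrightarrow> Q x t \<longleftrightarrow> \<sigma> * \<rho> * A.W\<^sub>\<delta> 1 1 x t > 0" for P Q X t\<^sub>0 t\<^sub>1 \<sigma> \<rho>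
    by (rule changes[of t\<^sub>0 t\<^sub>1 X "-1" \<sigma> \<rho> P]) (use that in \<open>auto simp: backward_characteristic_def\<close>)
  have mono: "deriv S x \<ge> 0" if "mono_on (I - E) m" "x \<in> I - E" for x
    using S'_sign(1) that by simp
  have anti: "deriv S x \<le> 0" if "antimono_on (I - E) m" "x \<in> I - E" for x
    using S'_sign(2) that by simp
  \<comment> \<open>Changing the sign of \<rho> reverses the character demanded of the opposite
    wave, which yields the symmetric half.\<close>
  show ?thesis
    apply (intro conjI impI allI)
    subgoal by (rule forward[where P = "forward_R J c p" and \<sigma> = "1" and \<rho> = "1"]) (simp_all add: char mono)
    subgoal by (rule forward[where P = "forward_C J c p" and \<sigma> = "-1" and \<rho> = "1"]) (simp_all add: char mono)
    subgoal by (rule backward[where P = "backward_C J c p" and \<sigma> = "-1" and \<rho> = "1"]) (simp_all add: char mono)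
    subgoal by (rule backward[where P = "backward_R J c p" and \<sigma> = "1" and \<rho> = "1"]) (simp_all add: char mono)
    subgoal by (rule forward[where P = "forward_R J c p" and \<sigma> = "1" and \<rho> = "-1"]) (simp_all add: char anti)
    subgoal by (rule forward[where P = "forward_C J c p" and \<sigma> = "-1" and \<rho> = "-1"]) (simp_all add: char anti)
    subgoal by (rule backward[where P = "backward_C J c p" and \<sigma> = "-1" and \<rho> = "-1"]) (simp_all add: char anti)
    subgoal by (rule backward[where P = "backward_R J c p" and \<sigma> = "1" and \<rho> = "-1"]) (simp_all add: char anti)
    done
qed

end
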